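(* Let the penalty $R=i_\Delta$ be the indicator function of the probability simplex $\Delta$, let $G=0$ and $\psi(v)=\frac12\|v\|_2^2$, and suppose $\tau\sigma\|K\|^2<1$, where $\tau,\sigma>0$. Then the function $$B(u,v)=\frac1\tau\varphi(u)+\frac1{2\sigma}\|v\|_2^2-\langle v,Ku\rangle$$ is convex. If, additionally, the source condition $-K^*v^\dagger\in\partial R(u^\dagger)$ is satisfied for some $v^\dagger\in L^2(\Gamma)$, then there exist $\nu>0$ and $\bar C>0$ such that for any $n\in\mathbb N$ one has $$D_R(\bar u^n,u^\dagger)+D_{H_{f^\delta}^*}(\bar v^n,v^\dagger)\le\frac1nD_B(w^\dagger,w^0)+\frac{2\bar C^2}{\nu}\delta^2n+2C\delta\sqrt{\frac{D_B(w^\dagger,w^0)}{\nu}},$$ where $\bar u^n=\frac1n\sum_{k=1}^nu^k$ and $\bar v^n=\frac1n\sum_{k=1}^nv^k$ ($n\ge1$) are the ergodic averages of the iterates of the entropic PDHG algorithm described in the context, $w^\dagger=(u^\dagger,v^\dagger)$, $w^0=(u^0,v^0)$, and $C$ is the constant of the perturbation condition in the context.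
   Context: Setting. $\Omega,\Gamma\subset\mathbb R^2$ are measurable sets; $K:L^1(\Omega)\to L^2(\Gamma)$ is a bounded linear operator; $\Delta=\{u\in L^1(\Omega):\int_\Omega u\,dt=1,\ u\ge0\text{ a.e.}\}$. $\varphi$ is the negative Boltzmann–Shannon entropy on $L^1(\Omega)$: $\varphi(u)=\int_\Omega u\ln u\,dt$ if $u\ge0$ a.e. and $u\ln u\in L^1(\Omega)$, and $\varphi(u)=+\infty$ otherwise. $B$ is a function on $L^1(\Omega)\times L^2(\Gamma)$ with values in $\mathbb R\cup\{+\infty\}$. $G$ denotes the smooth part of the objective $R+G$, and $\psi$ the dual reference function (giving the term $\frac1\sigma\psi(v)$ in $B$). Data. $f\in L^2(\Gamma)$ is the exact data and $f^\delta\in L^2(\Gamma)$ noisy data with $\|f-f^\delta\|_2\le\delta$. $H_f=i_{\{f\}}$ is the indicator function of $\{f\}$; $H_{f^\delta}:L^2(\Gamma)\to\mathbb R\cup\{+\infty\}$ is proper, convex and lower semicontinuous; $H^*$ denotes the Fenchel conjugate. $u^\dagger\in\Delta$ is a solution of $Ku=f$ (that is, of $\inf R(u)$ subject to $Ku=f$). Entropic PDHG algorithm. Starting from $u^0\in\Delta\cap\operatorname{dom}\partial\varphi$ and $v^0\in\operatorname{dom}\partial H_{f^\delta}^*$, for $k=0,1,2,\dots$: $$u^{k+1}=\frac{u^k\exp(-\tau K^*v^k)}{\int_\Omega u^k\exp(-\tau K^*v^k)\,dt},\qquad v^{k+1}=\operatorname{prox}_{\sigma H_{f^\delta}^*}\big(v^k+\sigma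 K(2u^{k+1}-u^k)\big),$$ where $\operatorname{prox}_{\sigma g}(x)=\arg\min_z\{g(z)+\frac1{2\sigma}\|z-x\|_2^2\}$. Perturbation condition (assumed throughout for this type of error estimate with noisy data): there exist a constant $C>0$ and subgradients $\zeta^\delta\in\partial H_{f^\delta}^*(v^\dagger)$, $\zeta\in\partial H_f^*(v^\dagger)$ such that $\langle\zeta^\delta-\zeta,v^\dagger-v^k\rangle\le C\delta\|v^\dagger-v^k\|_2$ for all $k\in\mathbb N$. Bregman distances. For convex $g$ and $\xi\in\partial g(y)$, $D_g(x,y)=g(x)-g(y)-\langle\xi,x-y\rangle$. $D_R(\cdot,u^\dagger)$ is taken with respect to $-K^*v^\dagger$, so that $D_R(\bar u^n,u^\dagger)=\langle K^*v^\dagger,\bar u^n-u^\dagger\rangle$; $D_{H_{f^\delta}^*}(\cdot,v^\dagger)$ is taken with respect to $\zeta^\delta$. $D_B$ is defined by means of the directional derivative: $D_B(w,\tilde w)=B(w)-B(\tilde w)-B'(\tilde w;w-\tilde w)$.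
   Formalization: Convexity of B is asserted on Δ×L²(Γ), not on all of L¹(Ω)×L²(Γ), where it fails: for u∈Δ with finite entropy and Ku≠0, s↦B(su,sσKu) has second derivative 1/(τs)−σ‖Ku‖², negative for large s. *)

theory Defs
  imports "HOL-Analysis.Analysis" "HOL-Library.Function_Algebras"
begin

instantiation "fun" :: (type, real_vector) real_vector
begin

definition scaleR_fun :: "real \<Rightarrow> ('a \<Rightarrow> 'b) \<Rightarrow> 'a \<Rightarrow> 'b" where
  "scaleR_fun a f = (\<lambda>x. a *\<^sub>R f x)"

instance
  by standard (simp_all add: scaleR_fun_def fun_eq_iff scaleR_add_right scaleR_add_left)

end

type_synonym point = "real ^ 2"
type_synonym fn = "point \<Rightarrow> real"


section \<open>Lebesgue spaces\<close>

text \<open>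
  Elements of the Lebesgue spaces over a measurable set \<open>S\<close> are represented by functions on the
  plane, with equality almost everywhere on \<open>S\<close> in place of equality; values outside
  \<open>S\<close> are irrelevant.
\<close>

definition L1 :: "point set \<Rightarrow> fn set" where
  "L1 S = {f. integrable (lebesgue_on S) f}"

definition L2 :: "point set \<Rightarrow> fn set" where
  "L2 S = {f. f \<in> borel_measurable (lebesgue_on S) \<and> integrable (lebesgue_on S) (\<lambda>x. (f x)\<^sup>2)}"

definition Linf :: "point set \<Rightarrow> fn set" where
  "Linf S = {f. f \<in> borel_measurable (lebesgue_on S) \<and> (\<exists>c. AE x in lebesgue_on S. \<bar>f x\<bar> \<le> c)}"

definition norm1 :: "point set \<Rightarrow> fn \<Rightarrow> real" where
  "norm1 S f = (\<integral>x. \<bar>f x\<bar> \<partial>lebesgue_on S)"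

definition norm2 :: "point set \<Rightarrow> fn \<Rightarrow> real" where
  "norm2 S f = sqrt (\<integral>x. (f x)\<^sup>2 \<partial>lebesgue_on S)"

text \<open>Both the inner product of \<open>L2\<close> and the duality pairing of \<open>Linf\<close> with \<open>L1\<close>.\<close>

definition pairing :: "point set \<Rightarrow> fn \<Rightarrow> fn \<Rightarrow> real" where
  "pairing S f g = (\<integral>x. f x * g x \<partial>lebesgue_on S)"


section \<open>Bounded operators from \<open>L1\<close> to \<open>L2\<close>\<close>

text \<open>Linearity almost everywhere and boundedness imply that \<open>K\<close> respects equality almost everywhere.\<close>

definition bounded_linear_L1_L2 :: "point set \<Rightarrow> point set \<Rightarrow> (fn \<Rightarrow> fn) \<Rightarrow> bool" where
  "bounded_linear_L1_L2 \<Omega> \<Gamma> K \<longleftrightarrow>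
     (\<forall>u\<in>L1 \<Omega>. K u \<in> L2 \<Gamma>) \<and>
     (\<forall>u\<in>L1 \<Omega>. \<forall>w\<in>L1 \<Omega>. AE x in lebesgue_on \<Gamma>. K (u + w) x = K u x + K w x) \<and>
     (\<forall>u\<in>L1 \<Omega>. \<forall>a. AE x in lebesgue_on \<Gamma>. K (a *\<^sub>R u) x = a * K u x) \<and>
     (\<exists>c. \<forall>u\<in>L1 \<Omega>. norm2 \<Gamma> (K u) \<le> c * norm1 \<Omega> u)"

definition op_norm :: "point set \<Rightarrow> point set \<Rightarrow> (fn \<Rightarrow> fn) \<Rightarrow> real" where
  "op_norm \<Omega> \<Gamma> K = (SUP u\<in>{u \<in> L1 \<Omega>. norm1 \<Omega> u \<le> 1}. norm2 \<Gamma> (K u))"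

text \<open>
  The Banach space adjoint, mapping into \<open>Linf \<Omega>\<close> as the dual space of \<open>L1 \<Omega>\<close>. The defining
  property determines \<open>adjoint_op \<Omega> \<Gamma> K v\<close> up to equality almost everywhere on \<open>\<Omega>\<close>.
\<close>

definition adjoint_op :: "point set \<Rightarrow> point set \<Rightarrow> (fn \<Rightarrow> fn) \<Rightarrow> fn \<Rightarrow> fn" where
  "adjoint_op \<Omega> \<Gamma> K v =
     (SOME g. g \<in> Linf \<Omega> \<and> (\<forall>u\<in>L1 \<Omega>. pairing \<Omega> g u = pairing \<Gamma> v (K u)))"


section \<open>Convex analysis of extended real valued functionals\<close>

text \<open>The weights are strictly between 0 and 1 since \<open>0 * \<infinity> = 0\<close> for extended reals.\<close>

definition convex_functional_on :: "'a::real_vector set \<Rightarrow> ('a \<Rightarrow> ereal) \<Rightarrow> bool" where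
  "convex_functional_on S F \<longleftrightarrow> convex S \<and>
     (\<forall>x\<in>S. \<forall>y\<in>S. \<forall>t. 0 < t \<and> t < 1 \<longrightarrow>
        F ((1 - t) *\<^sub>R x + t *\<^sub>R y) \<le> ereal (1 - t) * F x + ereal t * F y)"

definition proper_on :: "'a set \<Rightarrow> ('a \<Rightarrow> ereal) \<Rightarrow> bool" where
  "proper_on S F \<longleftrightarrow> (\<forall>x\<in>S. F x \<noteq> -\<infinity>) \<and> (\<exists>x\<in>S. F x \<noteq> \<infinity>)"

text \<open>
  Applied to constant sequences, this implies in particular that \<open>F\<close> respects equality almost
  everywhere.
\<close>

definition lsc_L2 :: "point set \<Rightarrow> (fn \<Rightarrow> ereal) \<Rightarrow> bool" where
  "lsc_L2 S F \<longleftrightarrow>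
     (\<forall>z\<in>L2 S. \<forall>y. (\<forall>n. y n \<in> L2 S) \<and> (\<lambda>n. norm2 S (y n - z)) \<longlonglongrightarrow> 0 \<longrightarrow>
        F z \<le> liminf (\<lambda>n. F (y n)))"

definition indicator_functional :: "fn set \<Rightarrow> fn \<Rightarrow> ereal" where
  "indicator_functional A x = (if x \<in> A then 0 else \<infinity>)"

text \<open>The singleton \<open>{f}\<close> of the Lebesgue space, that is, the class of \<open>f\<close>.\<close>

definition class_L2 :: "point set \<Rightarrow> fn \<Rightarrow> fn set" where
  "class_L2 S f = {z \<in> L2 S. AE x in lebesgue_on S. z x = f x}"

definition conjugate_L2 :: "point set \<Rightarrow> (fn \<Rightarrow> ereal) \<Rightarrow> fn \<Rightarrow> ereal" where
  "conjugate_L2 S H v = (SUP z\<in>L2 S. ereal (pairing S v z) - H z)"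

text \<open>\<open>X\<close> is the space on which \<open>g\<close> lives and \<open>Y\<close> its dual space.\<close>

definition subdifferential ::
  "point set \<Rightarrow> fn set \<Rightarrow> fn set \<Rightarrow> (fn \<Rightarrow> ereal) \<Rightarrow> fn \<Rightarrow> fn set" where
  "subdifferential S X Y g y =
     {\<xi> \<in> Y. y \<in> X \<and> \<bar>g y\<bar> \<noteq> \<infinity> \<and> (\<forall>x\<in>X. g y + ereal (pairing S \<xi> (x - y)) \<le> g x)}"

abbreviation subdiff_L1 :: "point set \<Rightarrow> (fn \<Rightarrow> ereal) \<Rightarrow> fn \<Rightarrow> fn set" where
  "subdiff_L1 S \<equiv> subdifferential S (L1 S) (Linf S)"

abbreviation subdiff_L2 :: "point set \<Rightarrow> (fn \<Rightarrow> ereal) \<Rightarrow> fn \<Rightarrow> fn set" where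
  "subdiff_L2 S \<equiv> subdifferential S (L2 S) (L2 S)"

text \<open>The Bregman distance of \<open>g\<close> between \<open>x\<close> and \<open>y\<close> with respect to the subgradient \<open>\<xi>\<close> at \<open>y\<close>.\<close>

definition bregman :: "point set \<Rightarrow> (fn \<Rightarrow> ereal) \<Rightarrow> fn \<Rightarrow> fn \<Rightarrow> fn \<Rightarrow> ereal" where
  "bregman S g \<xi> x y = g x - g y - ereal (pairing S \<xi> (x - y))"

definition directional_derivative :: "('a::real_vector \<Rightarrow> ereal) \<Rightarrow> 'a \<Rightarrow> 'a \<Rightarrow> ereal" where
  "directional_derivative F w h = Lim (at_right 0) (\<lambda>t. (F (w + t *\<^sub>R h) - F w) / ereal t)"

text \<open>
  If \<open>F w' = \<infinity>\<close> and \<open>F w\<close> is finite, this is \<open>\<infinity>\<close>, since \<open>\<infinity> - \<infinity> = \<infinity>\<close> for extended reals.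
\<close>

definition bregman_dd :: "('a::real_vector \<Rightarrow> ereal) \<Rightarrow> 'a \<Rightarrow> 'a \<Rightarrow> ereal" where
  "bregman_dd F w' w = F w' - F w - directional_derivative F w (w' - w)"

text \<open>The set of minimizers; a single class with respect to equality almost everywhere.\<close>

definition prox :: "point set \<Rightarrow> real \<Rightarrow> (fn \<Rightarrow> ereal) \<Rightarrow> fn \<Rightarrow> fn set" where
  "prox S \<sigma> g x =
     {p \<in> L2 S. \<forall>z\<in>L2 S.
        g p + ereal (1 / (2 * \<sigma>) * (norm2 S (p - x))\<^sup>2) \<le> g z + ereal (1 / (2 * \<sigma>) * (norm2 S (z - x))\<^sup>2)}"

definition ereal_sqrt :: "ereal \<Rightarrow> ereal" where
  "ereal_sqrt x = (if x = \<infinity> then \<infinity> else ereal (sqrt (real_of_ereal x)))"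


section \<open>The entropic primal-dual algorithm\<close>

definition prob_simplex :: "point set \<Rightarrow> fn set" where
  "prob_simplex \<Omega> =
     {u \<in> L1 \<Omega>. (\<integral>x. u x \<partial>lebesgue_on \<Omega>) = 1 \<and> (AE x in lebesgue_on \<Omega>. 0 \<le> u x)}"

text \<open>The convention \<open>0 ln 0 = 0\<close> is built in, since \<open>ln 0 = 0\<close>.\<close>

definition entropy :: "point set \<Rightarrow> fn \<Rightarrow> ereal" where
  "entropy \<Omega> u =
     (if (AE x in lebesgue_on \<Omega>. 0 \<le> u x) \<and> integrable (lebesgue_on \<Omega>) (\<lambda>x. u x * ln (u x))
      then ereal (\<integral>x. u x * ln (u x) \<partial>lebesgue_on \<Omega>) else \<infinity>)"

text \<open>
  Convexity of this functional is to be understood on \<open>prob_simplex \<Omega> \<times> L2 \<Gamma>\<close>, the simplex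
  being the domain of the penalty: if \<open>u\<close> is a point of finite entropy of the simplex with
  \<open>K u \<noteq> 0\<close>, then \<open>s \<mapsto> B (s u, s \<sigma> K u)\<close> is \<open>s ln s / \<tau> - s\<^sup>2 \<sigma> \<parallel>K u\<parallel>\<^sup>2 / 2\<close> up to a
  linear term, which is not convex for large \<open>s\<close>.
\<close>

definition B_functional ::
  "point set \<Rightarrow> point set \<Rightarrow> (fn \<Rightarrow> fn) \<Rightarrow> real \<Rightarrow> real \<Rightarrow> fn \<times> fn \<Rightarrow> ereal" where
  "B_functional \<Omega> \<Gamma> K \<tau> \<sigma> = (\<lambda>(u, v).
     ereal (1 / \<tau>) * entropy \<Omega> u + ereal (1 / (2 * \<sigma>) * (norm2 \<Gamma> v)\<^sup>2) - ereal (pairing \<Gamma> v (K u)))"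

definition entropic_pdhg ::
  "point set \<Rightarrow> point set \<Rightarrow> (fn \<Rightarrow> fn) \<Rightarrow> real \<Rightarrow> real \<Rightarrow> (fn \<Rightarrow> ereal) \<Rightarrow>
     (nat \<Rightarrow> fn) \<Rightarrow> (nat \<Rightarrow> fn) \<Rightarrow> bool" where
  "entropic_pdhg \<Omega> \<Gamma> K \<tau> \<sigma> H u v \<longleftrightarrow>
     u 0 \<in> prob_simplex \<Omega> \<and> subdiff_L1 \<Omega> (entropy \<Omega>) (u 0) \<noteq> {} \<and>
     subdiff_L2 \<Gamma> (conjugate_L2 \<Gamma> H) (v 0) \<noteq> {} \<and>
     (\<forall>k. u k \<in> L1 \<Omega> \<and> v k \<in> L2 \<Gamma>) \<and>
     (\<forall>k. AE x in lebesgue_on \<Omega>. u (Suc k) x =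
        u k x * exp (- \<tau> * adjoint_op \<Omega> \<Gamma> K (v k) x) /
          (\<integral>y. u k y * exp (- \<tau> * adjoint_op \<Omega> \<Gamma> K (v k) y) \<partial>lebesgue_on \<Omega>)) \<and>
     (\<forall>k. v (Suc k) \<in> prox \<Gamma> \<sigma> (conjugate_L2 \<Gamma> H) (v k + \<sigma> *\<^sub>R K (2 *\<^sub>R u (Suc k) - u k)))"

definition ergodic_mean :: "(nat \<Rightarrow> fn) \<Rightarrow> nat \<Rightarrow> fn" where
  "ergodic_mean x n = (1 / real n) *\<^sub>R (\<Sum>k = 1..n. x k)"

definition perturbation_condition ::
  "point set \<Rightarrow> fn \<Rightarrow> (fn \<Rightarrow> ereal) \<Rightarrow> real \<Rightarrow> real \<Rightarrow> fn \<Rightarrow> (nat \<Rightarrow> fn) \<Rightarrow> fn \<Rightarrow> fn \<Rightarrow> bool" where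
  "perturbation_condition \<Gamma> f H\<delta> \<delta> C v' v \<zeta>\<delta> \<zeta> \<longleftrightarrow>
     \<zeta>\<delta> \<in> subdiff_L2 \<Gamma> (conjugate_L2 \<Gamma> H\<delta>) v' \<and>
     \<zeta> \<in> subdiff_L2 \<Gamma> (conjugate_L2 \<Gamma> (indicator_functional (class_L2 \<Gamma> f))) v' \<and>
     (\<forall>k\<ge>1. pairing \<Gamma> (\<zeta>\<delta> - \<zeta>) (v' - v k) \<le> C * \<delta> * norm2 \<Gamma> (v' - v k))"

end

theory Submission
  imports Defs
begin

text \<open>
  Pinsker's inequality makes the entropy strongly convex on the simplex with respect to the norm of
  \<open>L1\<close>, and \<open>\<tau>\<sigma>\<parallel>K\<parallel>\<^sup>2 < 1\<close> lets this convexity absorb the bilinear term of \<open>B\<close>. The same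
  estimate shows \<open>D\<^sub>B(w\<^sup>\<dagger>, w) \<ge> \<nu>/2 \<parallel>v\<^sup>\<dagger> - v\<parallel>\<^sup>2\<close> with \<open>\<nu> = 1/\<sigma> - \<tau>\<parallel>K\<parallel>\<^sup>2\<close>.

  One step of the algorithm is a proximal step with respect to \<open>D\<^sub>B\<close>, so the three-point identity
  bounds the Bregman distances at \<open>w\<^sup>k\<^sup>+\<^sup>1\<close> by the decrease of \<open>D\<^sub>B(w\<^sup>\<dagger>, \<cdot>)\<close> plus the perturbation
  \<open>C\<delta>\<parallel>v\<^sup>\<dagger> - v\<^sup>k\<^sup>+\<^sup>1\<parallel>\<close>. Since the summed Bregman distances are nonnegative, the maximum of
  \<open>\<parallel>v\<^sup>\<dagger> - v\<^sup>k\<parallel>\<close> over \<open>k \<le> n\<close> satisfies a quadratic inequality, which bounds it by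
  \<open>2C\<delta>n/\<nu> + (2 D\<^sub>B(w\<^sup>\<dagger>, w\<^sup>0)/\<nu>)\<^sup>1\<^sup>/\<^sup>2\<close>. Summation and Jensen's inequality give the claim with \<open>C' = C\<close>.
\<close>

section \<open>The duality pairing and the norms\<close>

text \<open>The entropy is differentiated only along segments that start at a density bounded away
  from zero, and \<open>bregman_dd\<close> is a limit of extended reals. Two facts therefore shape
  the argument: the starting point lies in \<open>interior_simplex\<close>, because the slope of
  \<open>x * ln x\<close> is unbounded near zero while a subgradient lies in \<open>Linf\<close>;
  and the multiplicative update never leaves that set, because \<open>adjoint_op\<close> yields an
  essentially bounded function. At such points D_B is the real number \<open>B_distance\<close>, and
  the estimates become inequalities between reals. \<open>adjoint_op\<close> is a Hilbert choice, so
  it is worthless until every bounded functional on \<open>L1\<close> is known to be integration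
  against a bounded function. The constant \<open>\<nu>\<close> is what completing a square leaves
  of \<open>1 / \<sigma>\<close>. If \<open>u'\<close> has infinite entropy, D_B is infinite and the
  estimate is trivial.\<close>

lemma L1_iff: "f \<in> L1 S \<longleftrightarrow> integrable (lebesgue_on S) f"
  by (simp add: L1_def)

lemma L1_add: "f \<in> L1 S \<Longrightarrow> g \<in> L1 S \<Longrightarrow> f + g \<in> L1 S"
  and L1_diff: "f \<in> L1 S \<Longrightarrow> g \<in> L1 S \<Longrightarrow> f - g \<in> L1 S"
  and L1_scaleR: "f \<in> L1 S \<Longrightarrow> c *\<^sub>R f \<in> L1 S"
  by (simp_all add: L1_iff plus_fun_def fun_diff_def scaleR_fun_def)

lemma integrable_mult_of_squares:
  fixes f g :: "'a \<Rightarrow> real"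
  assumes [measurable]: "f \<in> borel_measurable M" "g \<in> borel_measurable M"
    and "integrable M (\<lambda>x. (f x)\<^sup>2)" "integrable M (\<lambda>x. (g x)\<^sup>2)"
  shows "integrable M (\<lambda>x. f x * g x)"
proof (rule Bochner_Integration.integrable_bound)
  show "integrable M (\<lambda>x. (f x)\<^sup>2 + (g x)\<^sup>2)"
    using assms by simp
  have "\<bar>f x * g x\<bar> \<le> (f x)\<^sup>2 + (g x)\<^sup>2" for x
    using sum_squares_bound[of "\<bar>f x\<bar>" "\<bar>g x\<bar>"] abs_ge_zero[of "f x * g x"]
    by (simp only: abs_mult power2_abs)
  then show "AE x in M. norm (f x * g x) \<le> norm ((f x)\<^sup>2 + (g x)\<^sup>2)"
    by (simp add: AE_I2)
qed measurable

lemma L2_add: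
  assumes "f \<in> L2 S" "g \<in> L2 S"
  shows "f + g \<in> L2 S"
proof -
  have "integrable (lebesgue_on S) (\<lambda>x. (f x)\<^sup>2 + (g x)\<^sup>2 + 2 * (f x * g x))"
    using assms integrable_mult_of_squares[of f "lebesgue_on S" g] by (simp add: L2_def)
  then show ?thesis
    using assms by (auto simp: L2_def plus_fun_def power2_sum mult.assoc)
qed

lemma L2_scaleR: "f \<in> L2 S \<Longrightarrow> c *\<^sub>R f \<in> L2 S"
  by (auto simp: L2_def scaleR_fun_def power_mult_distrib)

lemma L2_diff:
  assumes "f \<in> L2 S" "g \<in> L2 S"
  shows "f - g \<in> L2 S"
  using L2_add[OF assms(1) L2_scaleR[OF assms(2), of "-1"]]
  by (simp add: plus_fun_def fun_diff_def scaleR_fun_def)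

lemma convex_L2: "convex (L2 S)"
  by (simp add: convex_def L2_add L2_scaleR)

lemma integrable_L2_mult: "f \<in> L2 S \<Longrightarrow> g \<in> L2 S \<Longrightarrow> integrable (lebesgue_on S) (\<lambda>x. f x * g x)"
  by (intro integrable_mult_of_squares) (auto simp: L2_def)

lemma pairing_commute: "pairing S f g = pairing S g f"
  by (simp add: pairing_def mult.commute)

lemma pairing_add_right:
  "f \<in> L2 S \<Longrightarrow> g \<in> L2 S \<Longrightarrow> h \<in> L2 S \<Longrightarrow> pairing S f (g + h) = pairing S f g + pairing S f h"
  and pairing_diff_right:
  "f \<in> L2 S \<Longrightarrow> g \<in> L2 S \<Longrightarrow> h \<in> L2 S \<Longrightarrow> pairing S f (g - h) = pairing S f g - pairing S f h"
  by (simp_all add: pairing_def distrib_left right_diff_distrib integrable_L2_mult)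

lemma pairing_scaleR_right: "pairing S f (c *\<^sub>R g) = c * pairing S f g"
  by (simp add: pairing_def scaleR_fun_def mult.left_commute[of _ c])

lemma pairing_scaleR_left: "pairing S (c *\<^sub>R f) g = c * pairing S f g"
  by (metis pairing_commute pairing_scaleR_right)

lemma pairing_add_left:
  "f \<in> L2 S \<Longrightarrow> g \<in> L2 S \<Longrightarrow> h \<in> L2 S \<Longrightarrow> pairing S (f + g) h = pairing S f h + pairing S g h"
  and pairing_diff_left:
  "f \<in> L2 S \<Longrightarrow> g \<in> L2 S \<Longrightarrow> h \<in> L2 S \<Longrightarrow> pairing S (f - g) h = pairing S f h - pairing S g h"
  by (metis pairing_commute pairing_add_right) (metis pairing_commute pairing_diff_right)

lemmas pairing_linear =
  pairing_add_left pairing_add_right pairing_diff_left pairing_diff_right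
  pairing_scaleR_left pairing_scaleR_right

lemma pairing_cong_AE:
  assumes "f \<in> borel_measurable (lebesgue_on S)" "g \<in> borel_measurable (lebesgue_on S)"
    "g' \<in> borel_measurable (lebesgue_on S)" "AE x in lebesgue_on S. g x = g' x"
  shows "pairing S f g = pairing S f g'"
  unfolding pairing_def using assms by (intro integral_cong_AE) auto

lemma pairing_cong_AE_L2:
  "f \<in> L2 S \<Longrightarrow> g \<in> L2 S \<Longrightarrow> g' \<in> L2 S \<Longrightarrow> AE x in lebesgue_on S. g x = g' x \<Longrightarrow>
    pairing S f g = pairing S f g'"
  by (rule pairing_cong_AE) (auto simp: L2_def)

lemma norm1_nonneg: "0 \<le> norm1 S f"
  and norm2_nonneg: "0 \<le> norm2 S f"
  by (simp_all add: norm1_def norm2_def)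

lemma norm1_scaleR: "norm1 S (c *\<^sub>R f) = \<bar>c\<bar> * norm1 S f"
  by (simp add: norm1_def scaleR_fun_def abs_mult)

lemma power2_norm2: "(norm2 S f)\<^sup>2 = pairing S f f"
  by (simp add: norm2_def pairing_def power2_eq_square)

lemma norm2_scaleR: "norm2 S (c *\<^sub>R f) = \<bar>c\<bar> * norm2 S f"
  by (simp add: norm2_def scaleR_fun_def power_mult_distrib real_sqrt_mult)

lemma norm2_cong_AE:
  "f \<in> L2 S \<Longrightarrow> g \<in> L2 S \<Longrightarrow> AE x in lebesgue_on S. f x = g x \<Longrightarrow> norm2 S f = norm2 S g"
  unfolding norm2_def by (intro arg_cong[of _ _ sqrt] integral_cong_AE) (auto simp: L2_def)

lemma power2_norm2_add_scaleR:
  assumes "f \<in> L2 S" "g \<in> L2 S"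
  shows "(norm2 S (f + t *\<^sub>R g))\<^sup>2 = (norm2 S f)\<^sup>2 + 2 * t * pairing S f g + t\<^sup>2 * (norm2 S g)\<^sup>2"
  using assms
  by (simp add: power2_norm2 pairing_linear L2_add L2_scaleR pairing_commute[of S g f] algebra_simps
      power2_eq_square[of t])

text \<open>Cauchy-Schwarz by the discriminant: the squared norm of \<open>f + t *\<^sub>R g\<close>
  is a polynomial of degree at most two in \<open>t\<close> that is never negative.\<close>

lemma abs_pairing_le:
  assumes "f \<in> L2 S" "g \<in> L2 S"
  shows "\<bar>pairing S f g\<bar> \<le> norm2 S f * norm2 S g"
proof -
  define a b c where "a = (norm2 S f)\<^sup>2" and "b = pairing S f g" and "c = (norm2 S g)\<^sup>2"
  have quad: "0 \<le> a + 2 * t * b + t\<^sup>2 * c" for t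
    using power2_norm2_add_scaleR[OF assms, of t] by (metis a_def b_def c_def zero_le_power2)
  have "b\<^sup>2 \<le> a * c"
  proof (cases "c = 0")
    case True
    \<comment> \<open>With \<open>c = 0\<close> the polynomial is affine; if \<open>b\<close> were
      nonzero, the chosen \<open>t\<close> would give it the value -1.\<close>
    have "b = 0"
      using quad[of "- (a + 1) / (2 * b)"] True by (cases "b = 0") (auto simp: field_simps)
    then show ?thesis
      using True by simp
  next
    case False
    then have "0 < c"
      by (simp add: c_def)
    \<comment> \<open>\<open>t = - b / c\<close> is the minimiser of the quadratic.\<close>
    then show ?thesis
      using quad[of "- b / c"] by (simp add: field_simps power2_eq_square)
  qed
  then have "\<bar>b\<bar>\<^sup>2 \<le> (norm2 S f * norm2 S g)\<^sup>2"
    by (simp add: a_def c_def power_mult_distrib)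
  then show ?thesis
    unfolding b_def by (rule power2_le_imp_le) (simp add: norm2_nonneg)
qed

section \<open>Bounded linear functionals on \<open>L1\<close>\<close>

text \<open>
  If \<open>\<bar>l u\<bar> \<le> c \<parallel>u\<parallel>\<close>, the functional \<open>u \<mapsto> l u + c \<integral> u\<close> is positive, so no decomposition of
  signed measures is needed. Weighting with a positive integrable \<open>w\<close> makes the measure
  \<open>A \<mapsto> l (w 1\<^sub>A) + c \<integral>\<^sub>A w\<close> finite.
\<close>

lemma (in sigma_finite_measure) L1_functional_representation:
  fixes l :: "('a \<Rightarrow> real) \<Rightarrow> real"
  assumes add: "\<And>u w. integrable M u \<Longrightarrow> integrable M w \<Longrightarrow> l (\<lambda>x. u x + w x) = l u + l w"
    and scale: "\<And>a u. integrable M u \<Longrightarrow> l (\<lambda>x. a * u x) = a * l u"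
    and "0 \<le> c"
    and bound: "\<And>u. integrable M u \<Longrightarrow> \<bar>l u\<bar> \<le> c * (\<integral>x. \<bar>u x\<bar> \<partial>M)"
  obtains g where "g \<in> borel_measurable M" "AE x in M. \<bar>g x\<bar> \<le> c"
    "\<And>u. integrable M u \<Longrightarrow> l u = (\<integral>x. g x * u x \<partial>M)"
proof -
  have diff: "l (\<lambda>x. u x - w x) = l u - l w" if "integrable M u" "integrable M w" for u w
    using add[OF that(1), of "\<lambda>x. - 1 * w x"] scale[OF that(2), of "- 1"] that(2) by simp
  have cont: "(\<lambda>n. l (s n)) \<longlonglongrightarrow> l u"
    if s: "\<And>n. integrable M (s n)" and u: "integrable M u"
      and lim: "(\<lambda>n. \<integral>x. \<bar>s n x - u x\<bar> \<partial>M) \<longlonglongrightarrow> 0" for s u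
  proof -
    have lim_c: "(\<lambda>n. c * (\<integral>x. \<bar>s n x - u x\<bar> \<partial>M)) \<longlonglongrightarrow> 0"
      using tendsto_mult_left[OF lim, of c] by simp
    have "(\<lambda>n. l (s n) - l u) \<longlonglongrightarrow> 0"
    proof (rule Lim_null_comparison[OF always_eventually lim_c])
      show "\<forall>n. norm (l (s n) - l u) \<le> c * (\<integral>x. \<bar>s n x - u x\<bar> \<partial>M)"
        using bound[OF Bochner_Integration.integrable_diff[OF s u]] diff[OF s u] by simp
    qed
    then show ?thesis
      by (rule LIM_zero_cancel)
  qed
  obtain h where h[measurable]: "h \<in> borel_measurable M" and hfin: "integral\<^sup>N M h \<noteq> \<infinity>"
    and hpos: "\<And>x. x \<in> space M \<Longrightarrow> 0 < h x \<and> h x < \<infinity>"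
    using Ex_finite_integrable_function by auto
  define w where "w = (\<lambda>x. enn2real (h x))"
  have w[measurable]: "w \<in> borel_measurable M"
    by (simp add: w_def)
  have wpos: "0 < w x" if "x \<in> space M" for x
    using hpos[OF that] by (simp add: w_def enn2real_positive_iff)
  have wnn: "0 \<le> w x" for x
    by (simp add: w_def)
  have wint: "integrable M w"
  proof (rule integrableI_nonneg)
    have "(\<integral>\<^sup>+x. ennreal (w x) \<partial>M) = integral\<^sup>N M h"
      by (intro nn_integral_cong) (use hpos in \<open>auto simp: w_def less_top\<close>)
    then show "(\<integral>\<^sup>+x. ennreal (w x) \<partial>M) < \<infinity>"
      using hfin by (simp add: less_top)
  qed (use wnn in auto)
  have wA: "integrable M (\<lambda>x. w x * indicator A x)" if "A \<in> sets M" for A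
    using that wint by (intro integrable_real_mult_indicator) auto
  define m where "m A = c * (\<integral>x. w x * indicator A x \<partial>M) + l (\<lambda>x. w x * indicator A x)" for A
  have l_indicator: "\<bar>l (\<lambda>x. w x * indicator A x)\<bar> \<le> c * (\<integral>x. w x * indicator A x \<partial>M)"
    if "A \<in> sets M" for A
    using bound[OF wA[OF that]] wnn by (simp add: abs_mult)
  have m_nonneg: "0 \<le> m A" and m_le: "m A \<le> 2 * c * (\<integral>x. w x * indicator A x \<partial>M)"
    if "A \<in> sets M" for A
    using l_indicator[OF that] by (auto simp: m_def)
  have l0: "l (\<lambda>x. 0) = 0"
    using scale[of "\<lambda>x. 0" 0] by simp
  have m_empty: "m {} = 0"
    using l0 by (simp add: m_def)
  have m_union: "m (A \<union> B) = m A + m B" if "A \<in> sets M" "B \<in> sets M" "A \<inter> B = {}" for A B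
  proof -
    have "(\<lambda>x. w x * indicator (A \<union> B) x) = (\<lambda>x. w x * indicator A x + w x * indicator B x)"
      using that(3) by (auto simp: fun_eq_iff indicator_def)
    then show ?thesis
      using add[OF wA wA] wA that by (simp add: m_def distrib_left)
  qed
  have m_sums: "(\<lambda>i. m (A i)) sums m (\<Union>i. A i)"
    if A: "range A \<subseteq> sets M" and disj: "disjoint_family A" for A
  proof -
    define U where "U n = (\<Union>i<n. A i)" for n
    have U[measurable]: "U n \<in> sets M" "(\<Union>i. A i) \<in> sets M" for n
      using A by (auto simp: U_def)
    have part: "(\<Sum>i<n. m (A i)) = m (U n)" for n
    proof (induction n)
      case 0
      then show ?case by (simp add: U_def m_empty)
    next
      case (Suc n)
      have "A i \<inter> A n = {}" if "i < n" for i
        using disjoint_family_onD[OF disj, of i n] that by simp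
      then have "U n \<inter> A n = {}"
        by (auto simp: U_def)
      then have "m (U n \<union> A n) = m (U n) + m (A n)"
        using A U by (intro m_union) auto
      moreover have "U (Suc n) = U n \<union> A n"
        by (auto simp: U_def lessThan_Suc)
      ultimately show ?case
        using Suc by simp
    qed
    have ind_lim: "(\<lambda>n. indicator (U n) x :: real) \<longlonglongrightarrow> indicator (\<Union>i. A i) x" for x
      unfolding U_def by (rule LIMSEQ_indicator_UN)
    \<comment> \<open>Countable additivity comes from continuity of \<open>l\<close> in L1: the
      partial unions converge pointwise to the full union, dominated by
      \<open>2 * w\<close>.\<close>
    have "(\<lambda>n. \<integral>x. \<bar>w x * indicator (U n) x - w x * indicator (\<Union>i. A i) x\<bar> \<partial>M) \<longlonglongrightarrow> (\<integral>x. 0 \<partial>M)"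
    proof (rule integral_dominated_convergence[where w = "\<lambda>x. 2 * w x"])
      show "AE x in M. (\<lambda>n. \<bar>w x * indicator (U n) x - w x * indicator (\<Union>i. A i) x\<bar>) \<longlonglongrightarrow> 0"
        using ind_lim by (intro AE_I2 tendsto_rabs_zero LIM_zero tendsto_mult_left) auto
      show "AE x in M. norm \<bar>w x * indicator (U n) x - w x * indicator (\<Union>i. A i) x\<bar> \<le> 2 * w x" for n
        by (intro AE_I2) (use wnn in \<open>auto simp: indicator_def\<close>)
    qed (use wint in auto)
    then have lim0: "(\<lambda>n. \<integral>x. \<bar>w x * indicator (U n) x - w x * indicator (\<Union>i. A i) x\<bar> \<partial>M) \<longlonglongrightarrow> 0"
      by simp
    have "(\<lambda>n. \<integral>x. w x * indicator (U n) x \<partial>M) \<longlonglongrightarrow> (\<integral>x. w x * indicator (\<Union>i. A i) x \<partial>M)"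
    proof (rule integral_dominated_convergence[where w = w])
      show "AE x in M. (\<lambda>n. w x * indicator (U n) x) \<longlonglongrightarrow> w x * indicator (\<Union>i. A i) x"
        using ind_lim by (intro AE_I2 tendsto_mult_left) auto
      show "AE x in M. norm (w x * indicator (U n) x) \<le> w x" for n
        by (intro AE_I2) (use wnn in \<open>auto simp: indicator_def\<close>)
    qed (use wint in auto)
    then have "(\<lambda>n. m (U n)) \<longlonglongrightarrow> m (\<Union>i. A i)"
      unfolding m_def using cont[OF wA wA lim0] by (intro tendsto_add tendsto_mult_left) auto
    then show ?thesis
      by (simp add: sums_def part)
  qed
  define N where "N = measure_of (space M) (sets M) (\<lambda>A. ennreal (m A))"
  have setsN[simp]: "sets N = sets M"
    by (simp add: N_def)
  have emN: "emeasure N A = ennreal (m A)" if "A \<in> sets M" for A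
  proof (rule emeasure_measure_of[OF N_def])
    show "countably_additive (sets N) (\<lambda>A. ennreal (m A))"
    proof (rule countably_additiveI)
      fix A :: "nat \<Rightarrow> 'a set"
      assume "range A \<subseteq> sets N" "disjoint_family A"
      then have *: "(\<lambda>i. m (A i)) sums m (\<Union>i. A i)" "\<And>i. A i \<in> sets M"
        using m_sums by auto
      show "(\<Sum>i. ennreal (m (A i))) = ennreal (m (\<Union>i. A i))"
        by (intro suminf_ennreal_eq * m_nonneg)
    qed
    show "sets M \<subseteq> Pow (space M)"
      by (rule sets.space_closed)
    show "positive (sets N) (\<lambda>A. ennreal (m A))"
      by (simp add: positive_def m_empty)
    show "A \<in> sets N"
      using that by simp
  qed
  \<comment> \<open>\<open>m_le\<close> bounds \<open>m A\<close> by an integral over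
    \<open>A\<close>, which vanishes on null sets.\<close>
  have "absolutely_continuous M N"
    unfolding absolutely_continuous_def
  proof
    fix A assume A: "A \<in> null_sets M"
    then have "AE x in M. w x * indicator A x = 0"
      using AE_not_in[OF A] by (auto elim!: eventually_mono simp: indicator_def)
    then have "(\<integral>x. w x * indicator A x \<partial>M) = 0"
      by (simp add: integral_eq_zero_AE)
    then have "m A = 0"
      using m_nonneg[of A] m_le[of A] A by (auto simp: null_sets_def)
    then show "A \<in> null_sets N"
      using A emN[of A] by (auto simp: null_sets_def)
  qed
  then obtain f where f[measurable]: "f \<in> borel_measurable M" and dens: "density M f = N"
    using Radon_Nikodym[of N] by auto
  have fA: "(\<integral>\<^sup>+x. f x * indicator A x \<partial>M) = ennreal (m A)" if "A \<in> sets M" for A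
    using emN[OF that] dens emeasure_density[OF f that] by simp
  \<comment> \<open>If the density exceeded \<open>2 * c * w\<close> on a set of positive measure,
    its integral over that set would violate \<open>m_le\<close>. The bound also shows that
    \<open>f\<close> is finite almost everywhere.\<close>
  have f_le: "AE x in M. f x \<le> ennreal (2 * c * w x)"
  proof (rule ccontr)
    assume neg: "\<not> (AE x in M. f x \<le> ennreal (2 * c * w x))"
    define A where "A = {x \<in> space M. ennreal (2 * c * w x) < f x}"
    have A[measurable]: "A \<in> sets M"
      by (simp add: A_def)
    have cA: "(\<integral>\<^sup>+x. ennreal (2 * c * w x) * indicator A x \<partial>M)
        = ennreal (2 * c * (\<integral>x. w x * indicator A x \<partial>M))"
    proof -
      have "(\<integral>\<^sup>+x. ennreal (2 * c * w x) * indicator A x \<partial>M)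
          = (\<integral>\<^sup>+x. ennreal (2 * c * (w x * indicator A x)) \<partial>M)"
        by (intro nn_integral_cong) (auto simp: indicator_def)
      also have "\<dots> = ennreal (\<integral>x. 2 * c * (w x * indicator A x) \<partial>M)"
        using wA[OF A] wnn \<open>0 \<le> c\<close> by (intro nn_integral_eq_integral) auto
      finally show ?thesis
        by simp
    qed
    have "(\<integral>\<^sup>+x. ennreal (2 * c * w x) * indicator A x \<partial>M) < (\<integral>\<^sup>+x. f x * indicator A x \<partial>M)"
    proof (rule nn_integral_less)
      show "(\<integral>\<^sup>+x. ennreal (2 * c * w x) * indicator A x \<partial>M) \<noteq> \<infinity>"
        using cA by simp
      show "AE x in M. ennreal (2 * c * w x) * indicator A x \<le> f x * indicator A x"
        by (intro AE_I2) (auto simp: A_def indicator_def)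
      show "\<not> (AE x in M. f x * indicator A x \<le> ennreal (2 * c * w x) * indicator A x)"
      proof
        assume "AE x in M. f x * indicator A x \<le> ennreal (2 * c * w x) * indicator A x"
        then have "AE x in M. f x \<le> ennreal (2 * c * w x)"
          using AE_space by eventually_elim (auto simp: A_def not_le[symmetric] split: split_indicator_asm)
        then show False
          using neg by simp
      qed
    qed measurable
    then show False
      using fA[OF A] cA m_le[OF A] by (simp add: ennreal_leI leD)
  qed
  define r where "r = (\<lambda>x. enn2real (f x))"
  have r[measurable]: "r \<in> borel_measurable M"
    by (simp add: r_def)
  have f_r: "AE x in M. f x = ennreal (r x)"
    using f_le by eventually_elim (simp add: r_def, metis ennreal_enn2real ennreal_less_top le_less_trans)
  \<comment> \<open>Dividing by \<open>w\<close> undoes the weight and subtracting \<open>c\<close>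
    undoes the shift; \<open>0 \<le> r / w \<le> 2 * c\<close> becomes the bound \<open>c\<close> on
    the modulus of \<open>g\<close>.\<close>
  define g where "g = (\<lambda>x. r x / w x - c)"
  have g[measurable]: "g \<in> borel_measurable M"
    by (simp add: g_def)
  have g_bound: "AE x in M. \<bar>g x\<bar> \<le> c"
    using f_le f_r AE_space
  proof eventually_elim
    case (elim x)
    have "0 \<le> 2 * c * w x"
      using \<open>0 \<le> c\<close> wnn by simp
    then have "r x \<le> 2 * c * w x"
      using elim(1) unfolding elim(2) by (simp add: ennreal_le_iff)
    moreover have "0 \<le> r x"
      by (simp add: r_def)
    ultimately have "0 \<le> r x / w x" "r x / w x \<le> 2 * c"
      using wpos[OF elim(3)] by (simp_all add: divide_le_eq)
    then show ?case
      by (simp add: g_def)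
  qed
  have gw: "integrable M (\<lambda>x. g x * u x)" if "integrable M u" for u
  proof (rule Bochner_Integration.integrable_bound)
    show "integrable M (\<lambda>x. c * u x)"
      using that by simp
    show "AE x in M. norm (g x * u x) \<le> norm (c * u x)"
      using g_bound by eventually_elim (auto simp: abs_mult intro!: mult_right_mono)
  qed (use that in auto)
  have l_indicator_eq: "l (\<lambda>x. w x * indicator A x) = (\<integral>x. g x * (w x * indicator A x) \<partial>M)"
    if A[measurable]: "A \<in> sets M" for A
  proof -
    have "(\<integral>x. r x * indicator A x \<partial>M) = m A"
    proof -
      have "(\<integral>\<^sup>+x. ennreal (r x * indicator A x) \<partial>M) = (\<integral>\<^sup>+x. f x * indicator A x \<partial>M)"
        by (intro nn_integral_cong_AE) (use f_r in eventually_elim, auto simp: indicator_def)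
      then show ?thesis
        using fA[OF A] m_nonneg[OF A]
        by (subst integral_eq_nn_integral) (auto simp: r_def)
    qed
    moreover have "(\<integral>x. r x * indicator A x \<partial>M)
        = (\<integral>x. g x * (w x * indicator A x) + c * (w x * indicator A x) \<partial>M)"
      by (intro Bochner_Integration.integral_cong refl)
        (use wpos in \<open>force simp: g_def field_simps\<close>)
    ultimately show ?thesis
      using gw[OF wA[OF A]] wA[OF A] by (simp add: m_def)
  qed
  have int_dens: "integrable (density M w) s \<longleftrightarrow> integrable M (\<lambda>x. w x * s x)"
    if "s \<in> borel_measurable M" for s
    using that wnn by (intro integrable_real_density) auto
  \<comment> \<open>The identity is known for \<open>w * indicator A\<close>. Writing integrands as
    \<open>w * s\<close> lets the induction run over \<open>s\<close> in the finite measure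
    \<open>density M w\<close>.\<close>
  have main: "l (\<lambda>x. w x * s x) = (\<integral>x. g x * (w x * s x) \<partial>M)" if "integrable (density M w) s" for s
    using that
  proof (induct rule: integrable_induct)
    case (base A y)
    have [measurable]: "A \<in> sets M" using base by simp
    show ?case
      using scale[OF wA, of A y] l_indicator_eq[of A]
      by (simp add: algebra_simps)
  next
    case (add s t)
    have [measurable]: "s \<in> borel_measurable M" "t \<in> borel_measurable M"
      using add(1,3) by auto
    show ?case
      using add assms(1)[of "\<lambda>x. w x * s x" "\<lambda>x. w x * t x"] gw
      by (simp add: int_dens distrib_left)
  next
    case (lim f s)
    have [measurable]: "s i \<in> borel_measurable M" "f \<in> borel_measurable M" for i
      using lim(1,5) by auto
    have int: "integrable M (\<lambda>x. w x * s i x)" "integrable M (\<lambda>x. w x * f x)" for i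
      using lim(1,5) by (simp_all add: int_dens)
    \<comment> \<open>The induction rule supplies the factor 2 for \<open>s i\<close> against
      \<open>f\<close>; the triangle inequality adds one more.\<close>
    have w_le: "AE x in M. norm (\<bar>w x * s i x - w x * f x\<bar>) \<le> 3 * \<bar>w x * f x\<bar>" for i
    proof (intro AE_I2)
      fix x assume "x \<in> space M"
      then have "\<bar>w x * s i x\<bar> \<le> 2 * \<bar>w x * f x\<bar>"
        using mult_left_mono[OF lim(4)[of x i] wnn[of x]] wnn[of x] by (simp add: abs_mult)
      then show "norm (\<bar>w x * s i x - w x * f x\<bar>) \<le> 3 * \<bar>w x * f x\<bar>"
        by simp
    qed
    have lim_AE: "AE x in M. (\<lambda>i. w x * s i x) \<longlonglongrightarrow> w x * f x"
      using lim(3) by (intro AE_I2 tendsto_mult_left) auto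
    have "(\<lambda>i. \<integral>x. \<bar>w x * s i x - w x * f x\<bar> \<partial>M) \<longlonglongrightarrow> (\<integral>x. 0 \<partial>M)"
    proof (rule integral_dominated_convergence[OF _ _ _ _ w_le])
      show "AE x in M. (\<lambda>i. \<bar>w x * s i x - w x * f x\<bar>) \<longlonglongrightarrow> 0"
        using lim_AE by eventually_elim (intro tendsto_rabs_zero LIM_zero)
    qed (use int in auto)
    then have "(\<lambda>i. l (\<lambda>x. w x * s i x)) \<longlonglongrightarrow> l (\<lambda>x. w x * f x)"
      by (intro cont int) simp
    moreover have "(\<lambda>i. \<integral>x. g x * (w x * s i x) \<partial>M) \<longlonglongrightarrow> (\<integral>x. g x * (w x * f x) \<partial>M)"
    proof (rule integral_dominated_convergence[where w = "\<lambda>x. 2 * c * \<bar>w x * f x\<bar>"])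
      show "AE x in M. (\<lambda>i. g x * (w x * s i x)) \<longlonglongrightarrow> g x * (w x * f x)"
        using lim_AE by eventually_elim (rule tendsto_mult_left)
      show "AE x in M. norm (g x * (w x * s i x)) \<le> 2 * c * \<bar>w x * f x\<bar>" for i
        using g_bound AE_space
      proof eventually_elim
        case (elim x)
        have "\<bar>w x * s i x\<bar> \<le> 2 * \<bar>w x * f x\<bar>"
          using mult_left_mono[OF lim(4)[of x i] wnn[of x]] wnn[of x] elim by (simp add: abs_mult)
        then have "\<bar>g x\<bar> * \<bar>w x * s i x\<bar> \<le> c * (2 * \<bar>w x * f x\<bar>)"
          using elim \<open>0 \<le> c\<close> by (intro mult_mono) auto
        then show ?case
          by (simp add: abs_mult)
      qed
    qed (use int in auto)
    ultimately show ?case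
      unfolding lim(2) by (rule LIMSEQ_unique)
  qed
  show ?thesis
  proof
    fix u :: "'a \<Rightarrow> real"
    assume u: "integrable M u"
    have [measurable]: "u \<in> borel_measurable M"
      using u by simp
    \<comment> \<open>The equation may fail outside the space of \<open>M\<close>, so the two sides
      need not be equal as functions. \<open>bound\<close> shows that \<open>l\<close> does not see
      the difference.\<close>
    have cong: "AE x in M. w x * (u x / w x) = u x"
      by (intro AE_I2) (use wpos in force)
    have int: "integrable M (\<lambda>x. w x * (u x / w x))"
      using integrable_cong_AE[THEN iffD2, OF _ _ cong u] by simp
    have "AE x in M. \<bar>w x * (u x / w x) - u x\<bar> = 0"
      using cong by eventually_elim (simp only: diff_self abs_zero)
    then have "(\<integral>x. \<bar>w x * (u x / w x) - u x\<bar> \<partial>M) = 0"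
      by (rule integral_eq_zero_AE)
    then have null: "l (\<lambda>x. w x * (u x / w x) - u x) = 0"
      using bound[OF Bochner_Integration.integrable_diff[OF int u]] by simp
    have "l u = l (\<lambda>x. w x * (u x / w x)) - l (\<lambda>x. w x * (u x / w x) - u x)"
      using diff[OF int u] by simp
    also have "l (\<lambda>x. w x * (u x / w x)) = (\<integral>x. g x * (w x * (u x / w x)) \<partial>M)"
      using int by (intro main) (simp add: int_dens)
    also have "\<dots> = (\<integral>x. g x * u x \<partial>M)"
      using cong by (intro integral_cong_AE) auto
    finally show "l u = (\<integral>x. g x * u x \<partial>M)"
      using null by simp
  qed (use g g_bound in auto)
qed

section \<open>The operator and its adjoint\<close>

text \<open>A countable Borel cover by sets of finite measure serves \<open>lborel\<close> and its
  completion alike. This makes the representation of functionals available over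
  \<open>\<Omega>\<close>.\<close>

lemma sigma_finite_lebesgue_on:
  fixes S :: "'a::euclidean_space set"
  assumes "S \<in> sets lebesgue"
  shows "sigma_finite_measure (lebesgue_on S)"
proof -
  have "sigma_finite_measure (lebesgue :: 'a measure)"
  proof
    obtain A :: "'a set set" where A: "countable A" "A \<subseteq> sets lborel" "\<Union> A = space lborel"
      "\<forall>a\<in>A. emeasure lborel a \<noteq> \<infinity>"
      using lborel.sigma_finite_countable by auto
    then show "\<exists>A. countable A \<and> A \<subseteq> sets lebesgue \<and> \<Union> A = space lebesgue \<and>
        (\<forall>a\<in>A. emeasure (lebesgue :: 'a measure) a \<noteq> \<infinity>)"
      by (intro exI[of _ A]) (auto simp: subset_iff)
  qed
  then show ?thesis
    using assms by (rule sigma_finite_measure_restrict_space)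
qed

locale bounded_operator_L1_L2 =
  fixes \<Omega> \<Gamma> :: "point set" and K :: "fn \<Rightarrow> fn"
  assumes \<Omega>: "\<Omega> \<in> sets lebesgue"
    and K: "bounded_linear_L1_L2 \<Omega> \<Gamma> K"
begin

lemma K_L2: "u \<in> L1 \<Omega> \<Longrightarrow> K u \<in> L2 \<Gamma>"
  and K_add_AE: "u \<in> L1 \<Omega> \<Longrightarrow> w \<in> L1 \<Omega> \<Longrightarrow> AE x in lebesgue_on \<Gamma>. K (u + w) x = (K u + K w) x"
  and K_scaleR_AE: "u \<in> L1 \<Omega> \<Longrightarrow> AE x in lebesgue_on \<Gamma>. K (a *\<^sub>R u) x = (a *\<^sub>R K u) x"
  using K by (simp_all add: bounded_linear_L1_L2_def scaleR_fun_def)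

lemma pairing_K_add:
  "v \<in> L2 \<Gamma> \<Longrightarrow> u \<in> L1 \<Omega> \<Longrightarrow> w \<in> L1 \<Omega> \<Longrightarrow>
    pairing \<Gamma> v (K (u + w)) = pairing \<Gamma> v (K u) + pairing \<Gamma> v (K w)"
  using pairing_cong_AE_L2[of v \<Gamma> "K (u + w)" "K u + K w"] K_add_AE
  by (simp add: K_L2 L1_add L2_add pairing_add_right)

lemma pairing_K_scaleR:
  "v \<in> L2 \<Gamma> \<Longrightarrow> u \<in> L1 \<Omega> \<Longrightarrow> pairing \<Gamma> v (K (a *\<^sub>R u)) = a * pairing \<Gamma> v (K u)"
  using pairing_cong_AE_L2[OF _ _ _ K_scaleR_AE]
  by (simp add: K_L2 L1_scaleR L2_scaleR pairing_scaleR_right)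

lemma pairing_K_diff:
  assumes "v \<in> L2 \<Gamma>" "u \<in> L1 \<Omega>" "w \<in> L1 \<Omega>"
  shows "pairing \<Gamma> v (K (u - w)) = pairing \<Gamma> v (K u) - pairing \<Gamma> v (K w)"
  using assms pairing_K_add[of v u "(- 1) *\<^sub>R w"] pairing_K_scaleR[of v w "- 1"]
    L1_scaleR[of w \<Omega> "- 1"] by simp

lemma bounded_K: "\<exists>c. \<forall>u\<in>L1 \<Omega>. norm2 \<Gamma> (K u) \<le> c * norm1 \<Omega> u"
  using K by (simp add: bounded_linear_L1_L2_def)

text \<open>A real supremum is known to dominate its members only when the set is bounded above;
  this is what makes \<open>op_norm\<close> usable.\<close>

lemma bdd_above_K: "bdd_above ((\<lambda>u. norm2 \<Gamma> (K u)) ` {u \<in> L1 \<Omega>. norm1 \<Omega> u \<le> 1})"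
proof -
  obtain c where c: "\<And>u. u \<in> L1 \<Omega> \<Longrightarrow> norm2 \<Gamma> (K u) \<le> c * norm1 \<Omega> u"
    using bounded_K by blast
  show ?thesis
  proof (rule bdd_aboveI2)
    fix u assume u: "u \<in> {u \<in> L1 \<Omega>. norm1 \<Omega> u \<le> 1}"
    then have "c * norm1 \<Omega> u \<le> \<bar>c\<bar> * 1"
      by (intro mult_mono) (auto simp: norm1_nonneg)
    then show "norm2 \<Gamma> (K u) \<le> \<bar>c\<bar>"
      using c[of u] u by simp
  qed
qed

lemma norm2_K_le:
  assumes u: "u \<in> L1 \<Omega>"
  shows "norm2 \<Gamma> (K u) \<le> op_norm \<Omega> \<Gamma> K * norm1 \<Omega> u"
proof (cases "norm1 \<Omega> u = 0")
  case True
  \<comment> \<open>Such a \<open>u\<close> cannot be normalised, but any bounding constant already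
    forces the norm of \<open>K u\<close> to vanish.\<close>
  obtain c where "\<And>u. u \<in> L1 \<Omega> \<Longrightarrow> norm2 \<Gamma> (K u) \<le> c * norm1 \<Omega> u"
    using bounded_K by blast
  from this[OF u] show ?thesis
    using True by simp
next
  case False
  define s where "s = norm1 \<Omega> u"
  have s: "0 < s"
    using False norm1_nonneg[of \<Omega> u] by (simp add: s_def)
  have "norm2 \<Gamma> (K ((1 / s) *\<^sub>R u)) \<le> op_norm \<Omega> \<Gamma> K"
    unfolding op_norm_def using u s
    by (intro cSUP_upper[OF _ bdd_above_K]) (simp add: L1_scaleR norm1_scaleR s_def[symmetric])
  moreover have "norm2 \<Gamma> (K ((1 / s) *\<^sub>R u)) = norm2 \<Gamma> (K u) / s"
    using norm2_cong_AE[OF _ _ K_scaleR_AE[OF u]] u s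
    by (simp add: K_L2 L1_scaleR L2_scaleR norm2_scaleR)
  ultimately show ?thesis
    using s by (simp add: s_def divide_le_eq)
qed

lemma op_norm_nonneg: "0 \<le> op_norm \<Omega> \<Gamma> K"
proof -
  have "norm2 \<Gamma> (K 0) \<le> op_norm \<Omega> \<Gamma> K"
    unfolding op_norm_def
    by (intro cSUP_upper[OF _ bdd_above_K]) (simp add: L1_def norm1_def zero_fun_def)
  then show ?thesis
    using norm2_nonneg[of \<Gamma> "K 0"] by linarith
qed

lemma abs_pairing_K_le:
  assumes "v \<in> L2 \<Gamma>" "u \<in> L1 \<Omega>"
  shows "\<bar>pairing \<Gamma> v (K u)\<bar> \<le> op_norm \<Omega> \<Gamma> K * norm2 \<Gamma> v * norm1 \<Omega> u"
  using abs_pairing_le[OF assms(1) K_L2[OF assms(2)]]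
    mult_left_mono[OF norm2_K_le[OF assms(2)] norm2_nonneg[of \<Gamma> v]]
  by (simp add: algebra_simps)

text \<open>This is the specification behind the choice in \<open>adjoint_op\<close>. A witness
  exists because pairing \<open>v\<close> with \<open>K u\<close> is linear in \<open>u\<close>, as
  pairings ignore the null sets on which \<open>K\<close> fails to be linear, and bounded by
  \<open>op_norm \<Omega> \<Gamma> K * norm2 \<Gamma> v\<close>.\<close>

lemma adjoint_op:
  assumes v: "v \<in> L2 \<Gamma>"
  shows "adjoint_op \<Omega> \<Gamma> K v \<in> Linf \<Omega>"
    and "u \<in> L1 \<Omega> \<Longrightarrow> pairing \<Omega> (adjoint_op \<Omega> \<Gamma> K v) u = pairing \<Gamma> v (K u)"
proof -
  interpret sigma_finite_measure "lebesgue_on \<Omega>"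
    by (rule sigma_finite_lebesgue_on[OF \<Omega>])
  obtain g where "g \<in> borel_measurable (lebesgue_on \<Omega>)"
    "AE x in lebesgue_on \<Omega>. \<bar>g x\<bar> \<le> op_norm \<Omega> \<Gamma> K * norm2 \<Gamma> v"
    "\<And>u. integrable (lebesgue_on \<Omega>) u \<Longrightarrow> pairing \<Gamma> v (K u) = (\<integral>x. g x * u x \<partial>lebesgue_on \<Omega>)"
  proof (rule L1_functional_representation)
    show "pairing \<Gamma> v (K (\<lambda>x. u x + w x)) = pairing \<Gamma> v (K u) + pairing \<Gamma> v (K w)"
      if "integrable (lebesgue_on \<Omega>) u" "integrable (lebesgue_on \<Omega>) w" for u w
      using pairing_K_add[OF v, of u w] that by (simp add: L1_iff plus_fun_def)
    show "pairing \<Gamma> v (K (\<lambda>x. a * u x)) = a * pairing \<Gamma> v (K u)"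
      if "integrable (lebesgue_on \<Omega>) u" for a u
      using pairing_K_scaleR[OF v, of u a] that by (simp add: L1_iff scaleR_fun_def)
    show "\<bar>pairing \<Gamma> v (K u)\<bar> \<le> op_norm \<Omega> \<Gamma> K * norm2 \<Gamma> v * (\<integral>x. \<bar>u x\<bar> \<partial>lebesgue_on \<Omega>)"
      if "integrable (lebesgue_on \<Omega>) u" for u
      using abs_pairing_K_le[OF v, of u] that by (simp add: L1_iff norm1_def)
  qed (simp_all add: op_norm_nonneg norm2_nonneg)
  then have "\<exists>g. g \<in> Linf \<Omega> \<and> (\<forall>u\<in>L1 \<Omega>. pairing \<Omega> g u = pairing \<Gamma> v (K u))"
    by (intro exI[of _ g]) (auto simp: Linf_def L1_iff pairing_def)
  note * = someI_ex[OF this, folded adjoint_op_def]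
  show "adjoint_op \<Omega> \<Gamma> K v \<in> Linf \<Omega>"
    using * by simp
  show "u \<in> L1 \<Omega> \<Longrightarrow> pairing \<Omega> (adjoint_op \<Omega> \<Gamma> K v) u = pairing \<Gamma> v (K u)"
    using * by simp
qed

end

section \<open>Relative entropy\<close>

text \<open>\<open>2 * (x - 1) / (x + 1)\<close> is the Pade approximant of \<open>ln\<close> at 1.
  The difference vanishes at 1 and has the derivative
  \<open>(y - 1)^2 / (y * (y + 1)^2)\<close>.\<close>

lemma ln_ge_Pade:
  fixes x :: real
  assumes "1 \<le> x"
  shows "2 * (x - 1) \<le> (x + 1) * ln x"
proof -
  define k where "k y = ln y - 2 * (y - 1) / (y + 1)" for y :: real
  have "k 1 \<le> k x"
  proof (rule DERIV_nonneg_imp_nondecreasing[OF assms])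
    fix y :: real
    assume y: "1 \<le> y"
    have "(k has_real_derivative (1 / y - 4 / (y + 1)\<^sup>2)) (at y)"
      unfolding k_def[abs_def] using y
      by (auto intro!: derivative_eq_intros simp: field_simps power2_eq_square)
    moreover have "4 * y \<le> (y + 1)\<^sup>2"
      using zero_le_power2[of "y - 1"] by (simp add: power2_eq_square algebra_simps)
    then have "0 \<le> 1 / y - 4 / (y + 1)\<^sup>2"
      using y by (simp add: divide_simps)
    ultimately show "\<exists>d. (k has_real_derivative d) (at y) \<and> 0 \<le> d"
      by blast
  qed
  then show ?thesis
    using assms by (simp add: k_def divide_le_eq mult.commute)
qed

text \<open>The bound for arguments above 1, taken at \<open>1 / x\<close> and multiplied by
  \<open>x\<close>.\<close>

lemma ln_le_Pade:
  fixes x :: real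
  assumes "0 < x" "x \<le> 1"
  shows "(x + 1) * ln x \<le> 2 * (x - 1)"
proof -
  have "x * (2 * (1 / x - 1)) \<le> x * ((1 / x + 1) * ln (1 / x))"
    using ln_ge_Pade[of "1 / x"] assms by (intro mult_left_mono) auto
  also have "x * (2 * (1 / x - 1)) = 2 * (1 - x)"
    using assms by (simp add: field_simps)
  also have "x * ((1 / x + 1) * ln (1 / x)) = - ((x + 1) * ln x)"
    using assms by (simp add: ln_div field_simps)
  finally show ?thesis
    by simp
qed

text \<open>The pointwise core of Pinsker's inequality. The difference \<open>h\<close> of the two
  sides vanishes at 1, and by the two logarithm bounds its derivative has the sign of
  \<open>y - 1\<close>, so 1 is a minimum. The derivative is used at positive arguments only; the
  case \<open>x = 0\<close> reads \<open>3 \<le> 4\<close>.\<close>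

lemma pinsker_pointwise_normalized:
  fixes x :: real
  assumes "0 \<le> x"
  shows "3 * (x - 1)\<^sup>2 \<le> (2 * x + 4) * (x * ln x - x + 1)"
proof (cases "x = 0")
  case False
  define h where "h y = (2 * y + 4) * (y * ln y - y + 1) - 3 * (y - 1)\<^sup>2" for y :: real
  have deriv: "(h has_real_derivative 4 * ((y + 1) * ln y - 2 * (y - 1))) (at y)" if "0 < y" for y
    unfolding h_def[abs_def] using that
    by (auto intro!: derivative_eq_intros simp: algebra_simps)
  have "h 1 \<le> h x"
  proof (cases "1 \<le> x")
    case True
    show ?thesis
    proof (rule DERIV_nonneg_imp_nondecreasing[OF True])
      fix y :: real
      assume y: "1 \<le> y"
      show "\<exists>d. (h has_real_derivative d) (at y) \<and> 0 \<le> d"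
        by (rule exI, rule conjI, rule deriv) (use y ln_ge_Pade[OF y] in auto)
    qed
  next
    case False
    then have "x \<le> 1"
      by simp
    then show ?thesis
    proof (rule DERIV_nonpos_imp_nonincreasing)
      fix y :: real
      assume y: "x \<le> y" "y \<le> 1"
      then have "0 < y"
        using assms \<open>x \<noteq> 0\<close> by simp
      show "\<exists>d. (h has_real_derivative d) (at y) \<and> d \<le> 0"
        by (rule exI, rule conjI, rule deriv) (use y \<open>0 < y\<close> ln_le_Pade[of y] in auto)
    qed
  qed
  then show ?thesis
    by (simp add: h_def)
qed simp

lemma pinsker_pointwise:
  fixes a b :: real
  assumes "0 \<le> a" "0 < b"
  shows "3 * (a - b)\<^sup>2 \<le> (2 * a + 4 * b) * (a * ln a - a * ln b - a + b)"
proof -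
  have "3 * (a / b - 1)\<^sup>2 * b\<^sup>2 \<le> (2 * (a / b) + 4) * (a / b * ln (a / b) - a / b + 1) * b\<^sup>2"
    using assms by (intro mult_right_mono pinsker_pointwise_normalized) auto
  also have "3 * (a / b - 1)\<^sup>2 * b\<^sup>2 = 3 * (a - b)\<^sup>2"
    using assms by (simp add: field_simps power2_eq_square)
  also have "(2 * (a / b) + 4) * (a / b * ln (a / b) - a / b + 1) * b\<^sup>2
      = (2 * a + 4 * b) * (a * ln (a / b) - a + b)"
    using assms by (simp add: field_simps power2_eq_square)
  also have "a * ln (a / b) = a * ln a - a * ln b"
    using assms by (cases "a = 0") (auto simp: ln_div right_diff_distrib)
  finally show ?thesis .
qed

text \<open>The second factor on the right of \<open>pinsker_pointwise\<close> cannot be negative.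
  The result is the tangent inequality of the convex function \<open>x * ln x\<close> at
  \<open>b\<close>, after \<open>b * ln b\<close> has cancelled.\<close>

lemma entropy_gradient_ineq:
  fixes a b :: real
  assumes "0 \<le> a" "0 < b"
  shows "a - b \<le> a * ln a - a * ln b"
proof -
  have "0 \<le> (2 * a + 4 * b) * (a * ln a - a * ln b - a + b)"
    using pinsker_pointwise[OF assms] by (rule order_trans[rotated]) simp
  then show ?thesis
    using assms by (simp add: zero_le_mult_iff)
qed

text \<open>The pointwise bound gives \<open>(a - b)^2 \<le> p * q\<close>, where \<open>p\<close>
  has integral 2 and \<open>q\<close> has integral \<open>D\<close>. Young's inequality with a free
  weight \<open>s\<close> takes the place of Cauchy-Schwarz for the integrals. Since
  \<open>ln 0 = 0\<close>, the integrand would miss an infinite relative entropy where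
  \<open>b\<close> vanishes and \<open>a\<close> does not; the third hypothesis excludes
  this.\<close>

lemma pinsker:
  fixes a b :: "'a \<Rightarrow> real"
  assumes a: "integrable M a" and b: "integrable M b"
    and pos: "AE x in M. 0 \<le> a x \<and> 0 \<le> b x \<and> (b x = 0 \<longrightarrow> a x = 0)"
    and "(\<integral>x. a x \<partial>M) = 1" "(\<integral>x. b x \<partial>M) = 1"
    and d: "integrable M (\<lambda>x. a x * ln (a x) - a x * ln (b x))"
  shows "(\<integral>x. \<bar>a x - b x\<bar> \<partial>M)\<^sup>2 \<le> 2 * (\<integral>x. a x * ln (a x) - a x * ln (b x) \<partial>M)"
proof -
  define m D where "m = (\<integral>x. \<bar>a x - b x\<bar> \<partial>M)" and "D = (\<integral>x. a x * ln (a x) - a x * ln (b x) \<partial>M)"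
  define p q where "p x = (2 * a x + 4 * b x) / 3"
    and "q x = a x * ln (a x) - a x * ln (b x) - a x + b x" for x
  have p: "integrable M p" "(\<integral>x. p x \<partial>M) = 2" and q: "integrable M q" "(\<integral>x. q x \<partial>M) = D"
    using assms by (simp_all add: p_def[abs_def] q_def[abs_def] D_def)
  have est: "m \<le> s + D / (2 * s)" if "0 < s" for s
  proof -
    have "m \<le> (\<integral>x. (s * p x + q x / s) / 2 \<partial>M)"
      unfolding m_def
    proof (rule integral_mono_AE)
      show "AE x in M. \<bar>a x - b x\<bar> \<le> (s * p x + q x / s) / 2"
        using pos
      proof eventually_elim
        case (elim x)
        have *: "(a x - b x)\<^sup>2 \<le> p x * q x" "0 \<le> q x"
          using elim pinsker_pointwise[of "a x" "b x"] entropy_gradient_ineq[of "a x" "b x"]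
          by (cases "b x = 0"; simp add: p_def q_def)+
        have "(2 * \<bar>a x - b x\<bar>)\<^sup>2 \<le> 4 * (p x * q x)"
          using * by (simp add: power_mult_distrib)
        also have "\<dots> \<le> (s * p x + q x / s)\<^sup>2"
          using that zero_le_power2[of "s * p x - q x / s"]
          by (simp add: power2_eq_square algebra_simps)
        finally have "2 * \<bar>a x - b x\<bar> \<le> s * p x + q x / s"
          by (rule power2_le_imp_le) (use elim * that in \<open>simp add: p_def\<close>)
        then show ?case
          by simp
      qed
    qed (use a b p q in auto)
    also have "\<dots> = s + D / (2 * s)"
      using p q by (simp add: field_simps)
    finally show ?thesis .
  qed
  have "0 \<le> m"
    by (simp add: m_def)
  have "0 \<le> D"
    unfolding q(2)[symmetric]
  proof (rule integral_nonneg_AE)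
    show "AE x in M. 0 \<le> q x"
      using pos
    proof eventually_elim
      case (elim x)
      then show ?case
        using entropy_gradient_ineq[of "a x" "b x"] by (cases "b x = 0") (simp_all add: q_def)
    qed
  qed
  have "m\<^sup>2 \<le> 2 * D"
  proof (cases "m = 0")
    case False
    \<comment> \<open>\<open>s = m / 2\<close> minimises \<open>s + D / (2 * s)\<close> in the
      extremal case \<open>m^2 = 2 * D\<close>.\<close>
    then show ?thesis
      using est[of "m / 2"] \<open>0 \<le> m\<close> by (simp add: field_simps power2_eq_square)
  qed (use \<open>0 \<le> D\<close> in simp)
  then show ?thesis
    by (simp add: m_def D_def)
qed

text \<open>\<open>x * ln z\<close> lies above \<open>x * ln ((1 - t) * x)\<close>, since
  \<open>z\<close> is at least \<open>(1 - t) * x\<close>, and below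
  \<open>x * ln x + (z - x)\<close>, by the tangent inequality. Both bounds are integrable.\<close>

lemma integrable_mult_ln_mixture:
  fixes x y z :: "'a \<Rightarrow> real"
  assumes t: "0 < t" "t < 1"
    and x: "integrable M x" and y: "integrable M y" and nn: "AE p in M. 0 \<le> x p \<and> 0 \<le> y p"
    and x_ln: "integrable M (\<lambda>p. x p * ln (x p))"
    and z: "\<And>p. z p = (1 - t) * x p + t * y p"
  shows "integrable M (\<lambda>p. x p * ln (z p))"
proof -
  have [measurable]: "x \<in> borel_measurable M" "y \<in> borel_measurable M"
    using x y by auto
  have z_fun: "z = (\<lambda>p. (1 - t) * x p + t * y p)"
    using z by blast
  have [measurable]: "z \<in> borel_measurable M"
    unfolding z_fun by measurable
  have "integrable M (\<lambda>p. x p * ln (z p) - x p * ln (x p))"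
  proof (rule Bochner_Integration.integrable_bound)
    show "integrable M (\<lambda>p. \<bar>x p * ln (1 - t)\<bar> + (\<bar>x p\<bar> + \<bar>z p\<bar>))"
      unfolding z_fun using x y by simp
    show "AE p in M. norm (x p * ln (z p) - x p * ln (x p)) \<le> norm (\<bar>x p * ln (1 - t)\<bar> + (\<bar>x p\<bar> + \<bar>z p\<bar>))"
      using nn
    proof eventually_elim
      case (elim p)
      show ?case
      proof (cases "x p = 0")
        case False
        then have xp: "0 < x p" and le: "(1 - t) * x p \<le> z p"
          using elim t by (auto simp: z)
        then have zp: "0 < z p"
          using t by (intro less_le_trans[OF _ le]) simp
        have "ln (1 - t) + ln (x p) \<le> ln (z p)"
          using ln_mono[OF le] xp zp t by (simp add: ln_mult)
        then have "x p * (ln (1 - t) + ln (x p)) \<le> x p * ln (z p)"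
          using xp by (intro mult_left_mono) auto
        moreover have "x p * ln (z p) - x p * ln (x p) \<le> z p - x p"
          using entropy_gradient_ineq[of "x p" "z p"] xp zp by simp
        ultimately show ?thesis
          by (simp add: distrib_left)
      qed simp
    qed
  qed measurable
  from Bochner_Integration.integrable_add[OF this x_ln] show ?thesis
    by simp
qed

text \<open>The Jensen gap equals \<open>1 - t\<close> times the relative entropy of
  \<open>x\<close> to \<open>z\<close> plus \<open>t\<close> times that of \<open>y\<close> to
  \<open>z\<close>. Pinsker bounds both from below, with L1 distances \<open>t * m\<close> and
  \<open>(1 - t) * m\<close>, whose weighted squares add up to
  \<open>t * (1 - t) * m^2\<close>.\<close>

lemma entropy_strongly_convex:
  fixes x y z :: "'a \<Rightarrow> real"
  assumes t: "0 < t" "t < 1"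
    and x: "integrable M x" and y: "integrable M y" and nn: "AE p in M. 0 \<le> x p \<and> 0 \<le> y p"
    and int: "(\<integral>p. x p \<partial>M) = 1" "(\<integral>p. y p \<partial>M) = 1"
    and x_ln: "integrable M (\<lambda>p. x p * ln (x p))"
    and y_ln: "integrable M (\<lambda>p. y p * ln (y p))"
    and z: "\<And>p. z p = (1 - t) * x p + t * y p"
  shows "integrable M (\<lambda>p. z p * ln (z p))"
    and "(\<integral>p. z p * ln (z p) \<partial>M) + t * (1 - t) / 2 * (\<integral>p. \<bar>x p - y p\<bar> \<partial>M)\<^sup>2
      \<le> (1 - t) * (\<integral>p. x p * ln (x p) \<partial>M) + t * (\<integral>p. y p * ln (y p) \<partial>M)"
proof -
  have xz: "integrable M (\<lambda>p. x p * ln (z p))"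
    by (rule integrable_mult_ln_mixture[OF t x y nn x_ln z])
  have yz: "integrable M (\<lambda>p. y p * ln (z p))"
    using t nn z by (intro integrable_mult_ln_mixture[OF _ _ y x _ y_ln, of "1 - t"]) auto
  have z_ln: "z p * ln (z p) = (1 - t) * (x p * ln (z p)) + t * (y p * ln (z p))" for p
    by (simp add: z algebra_simps)
  show "integrable M (\<lambda>p. z p * ln (z p))"
    unfolding z_ln using xz yz by simp
  have z_fun: "z = (\<lambda>p. (1 - t) * x p + t * y p)"
    using z by blast
  have z_int: "integrable M z" "(\<integral>p. z p \<partial>M) = 1"
    unfolding z_fun using x y int by simp_all
  have pos: "AE p in M. 0 \<le> x p \<and> 0 \<le> z p \<and> (z p = 0 \<longrightarrow> x p = 0)"
    "AE p in M. 0 \<le> y p \<and> 0 \<le> z p \<and> (z p = 0 \<longrightarrow> y p = 0)"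
    using nn by (eventually_elim, use t in \<open>auto simp: z add_nonneg_eq_0_iff\<close>)+
  define m where "m = (\<integral>p. \<bar>x p - y p\<bar> \<partial>M)"
  have "(\<integral>p. \<bar>x p - z p\<bar> \<partial>M) = (\<integral>p. t * \<bar>x p - y p\<bar> \<partial>M)"
  proof (intro Bochner_Integration.integral_cong refl)
    fix p
    have "x p - z p = t * (x p - y p)"
      by (simp add: z algebra_simps)
    then show "\<bar>x p - z p\<bar> = t * \<bar>x p - y p\<bar>"
      using t by (simp add: abs_mult)
  qed
  then have mx: "(t * m)\<^sup>2 \<le> 2 * (\<integral>p. x p * ln (x p) - x p * ln (z p) \<partial>M)"
    using pinsker[OF x z_int(1) pos(1) int(1) z_int(2)] x_ln xz by (simp add: m_def)
  have "(\<integral>p. \<bar>y p - z p\<bar> \<partial>M) = (\<integral>p. (1 - t) * \<bar>x p - y p\<bar> \<partial>M)"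
  proof (intro Bochner_Integration.integral_cong refl)
    fix p
    have "y p - z p = (1 - t) * (y p - x p)"
      by (simp add: z algebra_simps)
    then show "\<bar>y p - z p\<bar> = (1 - t) * \<bar>x p - y p\<bar>"
      using t by (simp add: abs_mult abs_minus_commute)
  qed
  then have my: "((1 - t) * m)\<^sup>2 \<le> 2 * (\<integral>p. y p * ln (y p) - y p * ln (z p) \<partial>M)"
    using pinsker[OF y z_int(1) pos(2) int(2) z_int(2)] y_ln yz by (simp add: m_def)
  have "t * (1 - t) * m\<^sup>2 = (1 - t) * (t * m)\<^sup>2 + t * ((1 - t) * m)\<^sup>2"
    by (simp add: power2_eq_square algebra_simps)
  also have "\<dots> \<le> (1 - t) * (2 * (\<integral>p. x p * ln (x p) - x p * ln (z p) \<partial>M))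
      + t * (2 * (\<integral>p. y p * ln (y p) - y p * ln (z p) \<partial>M))"
    using t by (intro add_mono mult_left_mono mx my) auto
  also have "\<dots> = 2 * ((1 - t) * (\<integral>p. x p * ln (x p) \<partial>M) + t * (\<integral>p. y p * ln (y p) \<partial>M)
      - (\<integral>p. z p * ln (z p) \<partial>M))"
    unfolding z_ln using xz yz x_ln y_ln by (simp add: algebra_simps)
  finally show "(\<integral>p. z p * ln (z p) \<partial>M) + t * (1 - t) / 2 * (\<integral>p. \<bar>x p - y p\<bar> \<partial>M)\<^sup>2
      \<le> (1 - t) * (\<integral>p. x p * ln (x p) \<partial>M) + t * (\<integral>p. y p * ln (y p) \<partial>M)"
    by (simp add: m_def)
qed

section \<open>The functional \<open>B\<close>\<close>

definition finite_entropy_simplex :: "point set \<Rightarrow> fn set" where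
  "finite_entropy_simplex \<Omega> =
     {u \<in> prob_simplex \<Omega>. integrable (lebesgue_on \<Omega>) (\<lambda>x. u x * ln (u x))}"

definition entropy_integral :: "point set \<Rightarrow> fn \<Rightarrow> real" where
  "entropy_integral \<Omega> u = (\<integral>x. u x * ln (u x) \<partial>lebesgue_on \<Omega>)"

text \<open>The Kullback-Leibler divergence. It is the Bregman distance of the entropy on the
  simplex, where the remaining term \<open>b - a\<close> integrates to zero.\<close>

definition rel_entropy :: "point set \<Rightarrow> fn \<Rightarrow> fn \<Rightarrow> real" where
  "rel_entropy \<Omega> a b = (\<integral>x. a x * ln (a x) - a x * ln (b x) \<partial>lebesgue_on \<Omega>)"

text \<open>
  Being bounded away from zero almost everywhere is what membership in \<open>dom \<partial>\<phi>\<close> amounts to in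
  \<open>L1\<close>. It makes the entropy differentiable in the directions of the simplex.
\<close>

definition interior_simplex :: "point set \<Rightarrow> fn set" where
  "interior_simplex \<Omega> =
     {u \<in> finite_entropy_simplex \<Omega>. \<exists>c>0. AE x in lebesgue_on \<Omega>. c \<le> u x}"

section \<open>Densities of finite entropy and densities bounded away from zero\<close>

lemma prob_simplexD:
  assumes "u \<in> prob_simplex \<Omega>"
  shows "integrable (lebesgue_on \<Omega>) u" "(\<integral>x. u x \<partial>lebesgue_on \<Omega>) = 1"
    "AE x in lebesgue_on \<Omega>. 0 \<le> u x"
  using assms by (simp_all add: prob_simplex_def L1_iff)

lemma prob_simplex_L1: "u \<in> prob_simplex \<Omega> \<Longrightarrow> u \<in> L1 \<Omega>"
  by (simp add: prob_simplex_def)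

lemma finite_entropy_simplexD:
  assumes "u \<in> finite_entropy_simplex \<Omega>"
  shows "u \<in> prob_simplex \<Omega>" "u \<in> L1 \<Omega>" "integrable (lebesgue_on \<Omega>) (\<lambda>x. u x * ln (u x))"
  using assms by (simp_all add: finite_entropy_simplex_def prob_simplex_L1)

lemma interior_simplexD:
  assumes "u \<in> interior_simplex \<Omega>"
  shows "u \<in> finite_entropy_simplex \<Omega>" "u \<in> prob_simplex \<Omega>" "u \<in> L1 \<Omega>"
  using assms by (simp_all add: interior_simplex_def finite_entropy_simplexD)

lemma interior_simplex_pos:
  assumes "u \<in> interior_simplex \<Omega>"
  shows "AE x in lebesgue_on \<Omega>. 0 < u x"
proof -
  obtain c where "0 < c" "AE x in lebesgue_on \<Omega>. c \<le> u x"
    using assms by (auto simp: interior_simplex_def)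
  from this(2) show ?thesis
    by eventually_elim (use \<open>0 < c\<close> in simp)
qed

lemma convex_prob_simplex: "convex (prob_simplex \<Omega>)"
proof (rule convexI)
  fix x y :: fn and s t :: real
  assume *: "x \<in> prob_simplex \<Omega>" "y \<in> prob_simplex \<Omega>" "0 \<le> s" "0 \<le> t" "s + t = 1"
  have "AE p in lebesgue_on \<Omega>. 0 \<le> s * x p + t * y p"
    using prob_simplexD(3)[OF *(1)] prob_simplexD(3)[OF *(2)]
    by eventually_elim (use * in simp)
  then show "s *\<^sub>R x + t *\<^sub>R y \<in> prob_simplex \<Omega>"
    using prob_simplexD[OF *(1)] prob_simplexD[OF *(2)] *(5)
    by (simp add: prob_simplex_def L1_iff plus_fun_def scaleR_fun_def)
qed

lemma entropy_eq:
  "u \<in> finite_entropy_simplex \<Omega> \<Longrightarrow> entropy \<Omega> u = ereal (entropy_integral \<Omega> u)"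
  by (simp add: finite_entropy_simplex_def prob_simplex_def entropy_def entropy_integral_def)

lemma entropy_eq_infinity:
  "u \<notin> finite_entropy_simplex \<Omega> \<Longrightarrow> u \<in> prob_simplex \<Omega> \<Longrightarrow> entropy \<Omega> u = \<infinity>"
  by (simp add: finite_entropy_simplex_def prob_simplex_def entropy_def)

lemma finite_entropy_simplex_mix:
  assumes "x \<in> finite_entropy_simplex \<Omega>" "y \<in> finite_entropy_simplex \<Omega>" "0 < t" "t < 1"
  shows "(1 - t) *\<^sub>R x + t *\<^sub>R y \<in> finite_entropy_simplex \<Omega>"
    and "entropy_integral \<Omega> ((1 - t) *\<^sub>R x + t *\<^sub>R y) + t * (1 - t) / 2 * (norm1 \<Omega> (x - y))\<^sup>2
      \<le> (1 - t) * entropy_integral \<Omega> x + t * entropy_integral \<Omega> y"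
proof -
  note x = finite_entropy_simplexD[OF assms(1)] and y = finite_entropy_simplexD[OF assms(2)]
  have nn: "AE p in lebesgue_on \<Omega>. 0 \<le> x p \<and> 0 \<le> y p"
    using prob_simplexD(3)[OF x(1)] prob_simplexD(3)[OF y(1)] by eventually_elim simp
  note * = entropy_strongly_convex[OF assms(3,4) prob_simplexD(1)[OF x(1)] prob_simplexD(1)[OF y(1)] nn
      prob_simplexD(2)[OF x(1)] prob_simplexD(2)[OF y(1)] x(3) y(3),
      of "(1 - t) *\<^sub>R x + t *\<^sub>R y"]
  have eq: "((1 - t) *\<^sub>R x + t *\<^sub>R y) p = (1 - t) * x p + t * y p" for p
    by (simp add: scaleR_fun_def)
  have "(1 - t) *\<^sub>R x + t *\<^sub>R y \<in> prob_simplex \<Omega>"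
    using convexD[OF convex_prob_simplex x(1) y(1)] assms(3,4) by simp
  then show "(1 - t) *\<^sub>R x + t *\<^sub>R y \<in> finite_entropy_simplex \<Omega>"
    using *(1)[OF eq] by (simp add: finite_entropy_simplex_def)
  show "entropy_integral \<Omega> ((1 - t) *\<^sub>R x + t *\<^sub>R y) + t * (1 - t) / 2 * (norm1 \<Omega> (x - y))\<^sup>2
      \<le> (1 - t) * entropy_integral \<Omega> x + t * entropy_integral \<Omega> y"
    using *(2)[OF eq] by (simp add: entropy_integral_def norm1_def)
qed

text \<open>The lower bound \<open>c\<close> of \<open>b\<close> gives
  \<open>a * ln c \<le> a * ln b\<close>, and the tangent inequality bounds \<open>a * ln b\<close>
  from above by \<open>a * ln a - a + b\<close>.\<close>

lemma integrable_mult_ln_interior: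
  assumes a: "a \<in> finite_entropy_simplex \<Omega>" and b: "b \<in> interior_simplex \<Omega>"
  shows "integrable (lebesgue_on \<Omega>) (\<lambda>x. a x * ln (b x))"
proof -
  note a' = finite_entropy_simplexD[OF a] and b' = interior_simplexD[OF b]
  note [measurable] = borel_measurable_integrable[OF prob_simplexD(1)[OF a'(1)]]
    borel_measurable_integrable[OF prob_simplexD(1)[OF b'(2)]]
  obtain c where c: "0 < c" "AE x in lebesgue_on \<Omega>. c \<le> b x"
    using b by (auto simp: interior_simplex_def)
  show ?thesis
  proof (rule Bochner_Integration.integrable_bound)
    show "integrable (lebesgue_on \<Omega>) (\<lambda>x. \<bar>a x * ln c\<bar> + \<bar>a x * ln (a x)\<bar> + \<bar>a x\<bar> + \<bar>b x\<bar>)"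
      using a'(3) prob_simplexD(1)[OF a'(1)] prob_simplexD(1)[OF b'(2)] by simp
    show "AE x in lebesgue_on \<Omega>.
        norm (a x * ln (b x)) \<le> norm (\<bar>a x * ln c\<bar> + \<bar>a x * ln (a x)\<bar> + \<bar>a x\<bar> + \<bar>b x\<bar>)"
      using c(2) prob_simplexD(3)[OF a'(1)]
    proof eventually_elim
      case (elim x)
      have "a x * ln c \<le> a x * ln (b x)"
        using elim c(1) by (intro mult_left_mono) auto
      moreover have "a x - b x \<le> a x * ln (a x) - a x * ln (b x)"
        using elim c(1) by (intro entropy_gradient_ineq) auto
      ultimately show ?case
        by simp
    qed
  qed measurable
qed

lemma rel_entropy_eq:
  assumes "a \<in> finite_entropy_simplex \<Omega>" "b \<in> interior_simplex \<Omega>"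
  shows "rel_entropy \<Omega> a b = entropy_integral \<Omega> a - (\<integral>x. a x * ln (b x) \<partial>lebesgue_on \<Omega>)"
  using integrable_mult_ln_interior[OF assms] finite_entropy_simplexD[OF assms(1)]
  by (simp add: rel_entropy_def entropy_integral_def)

lemma rel_entropy_ge:
  assumes "a \<in> finite_entropy_simplex \<Omega>" "b \<in> interior_simplex \<Omega>"
  shows "(norm1 \<Omega> (a - b))\<^sup>2 \<le> 2 * rel_entropy \<Omega> a b"
proof -
  note a = finite_entropy_simplexD[OF assms(1)] and b = interior_simplexD[OF assms(2)]
  have pos: "AE x in lebesgue_on \<Omega>. 0 \<le> a x \<and> 0 \<le> b x \<and> (b x = 0 \<longrightarrow> a x = 0)"
    using prob_simplexD(3)[OF a(1)] interior_simplex_pos[OF assms(2)] by eventually_elim simp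
  show ?thesis
    using pinsker[OF prob_simplexD(1)[OF a(1)] prob_simplexD(1)[OF b(2)] pos
        prob_simplexD(2)[OF a(1)] prob_simplexD(2)[OF b(2)]]
      integrable_mult_ln_interior[OF assms] a(3)
    by (simp add: rel_entropy_def norm1_def)
qed

text \<open>The slope \<open>1 + ln x\<close> tends to minus infinity at zero, whereas a subgradient
  is essentially bounded. Raising \<open>u\<close> to a small level \<open>e\<close> on a set where
  it lies below \<open>e\<close> would therefore lower the entropy faster than the subgradient
  permits. The raised function leaves the simplex, which is allowed because the subgradient
  inequality holds on all of \<open>L1\<close>.\<close>

lemma dom_subdifferential_entropy:
  assumes \<Omega>: "\<Omega> \<in> sets lebesgue" and u: "u \<in> prob_simplex \<Omega>"
    and sub: "subdiff_L1 \<Omega> (entropy \<Omega>) u \<noteq> {}"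
  shows "u \<in> interior_simplex \<Omega>"
proof -
  let ?M = "lebesgue_on \<Omega>"
  interpret sigma_finite_measure ?M
    by (rule sigma_finite_lebesgue_on[OF \<Omega>])
  obtain \<zeta> where \<zeta>: "\<zeta> \<in> Linf \<Omega>" "\<bar>entropy \<Omega> u\<bar> \<noteq> \<infinity>"
    "\<And>x. x \<in> L1 \<Omega> \<Longrightarrow> entropy \<Omega> u + ereal (pairing \<Omega> \<zeta> (x - u)) \<le> entropy \<Omega> x"
    using sub by (auto simp: subdifferential_def)
  have fin: "u \<in> finite_entropy_simplex \<Omega>"
    using entropy_eq_infinity[OF _ u] \<zeta>(2) by fastforce
  note u_int = prob_simplexD[OF u] and u_ln = finite_entropy_simplexD(3)[OF fin]
  note [measurable] = borel_measurable_integrable[OF u_int(1)]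
  obtain c where c: "AE x in ?M. \<bar>\<zeta> x\<bar> \<le> c" and [measurable]: "\<zeta> \<in> borel_measurable ?M"
    using \<zeta>(1) by (auto simp: Linf_def)
  \<comment> \<open>The slope of \<open>x * ln x\<close> at this level is \<open>- c - 1\<close>,
    which beats the bound \<open>- c\<close> by exactly 1.\<close>
  define e where "e = exp (- c - 2)"
  have e: "0 < e" "ln e = - c - 2"
    by (simp_all add: e_def)
  define S where "S = {x \<in> space ?M. u x < e}"
  have S[measurable]: "S \<in> sets ?M"
    unfolding S_def by measurable
  \<comment> \<open>Finite measure makes the constant \<open>e\<close> integrable over
    \<open>A\<close>, so that the perturbation \<open>h\<close> is in \<open>L1\<close>.\<close>
  have null: "A \<in> null_sets ?M" if A[measurable]: "A \<in> sets ?M" and "A \<subseteq> S" and "emeasure ?M A \<noteq> \<infinity>" for A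
  proof -
    define h where "h = (\<lambda>p. (e - u p) * indicator A p)"
    have h_int: "integrable ?M h"
      using integrable_real_mult_indicator[OF A u_int(1)] that(3)
      by (simp add: h_def left_diff_distrib less_top[symmetric])
    have h_nn: "0 \<le> h p" for p
      using \<open>A \<subseteq> S\<close> by (auto simp: h_def S_def indicator_def)
    have x_ln: "(u p + h p) * ln (u p + h p) = u p * ln (u p) + (e * ln e - u p * ln (u p)) * indicator A p" for p
      by (simp add: h_def indicator_def)
    have ln_int: "integrable ?M (\<lambda>p. (e * ln e - u p * ln (u p)) * indicator A p)"
      using integrable_real_mult_indicator[OF A u_ln] that(3)
      by (simp add: left_diff_distrib less_top[symmetric])
    have x_L1: "u + h \<in> L1 \<Omega>"
      using u_int(1) h_int by (simp add: L1_iff plus_fun_def)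
    have "AE p in ?M. 0 \<le> (u + h) p"
      using u_int(3) by eventually_elim (simp add: h_nn)
    then have ent_x: "entropy \<Omega> (u + h) =
        ereal (entropy_integral \<Omega> u + (\<integral>p. (e * ln e - u p * ln (u p)) * indicator A p \<partial>?M))"
      using u_ln ln_int by (simp add: entropy_def entropy_integral_def x_ln)
    have \<zeta>h: "integrable ?M (\<lambda>p. \<zeta> p * h p)"
    proof (rule Bochner_Integration.integrable_bound)
      show "integrable ?M (\<lambda>p. c * h p)"
        using h_int by simp
      show "AE p in ?M. norm (\<zeta> p * h p) \<le> norm (c * h p)"
        using c by eventually_elim (auto simp: abs_mult intro!: mult_right_mono)
    qed (use h_int in auto)
    have "- c * (\<integral>p. h p \<partial>?M) = (\<integral>p. - c * h p \<partial>?M)"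
      by simp
    also have "\<dots> \<le> pairing \<Omega> \<zeta> h"
      unfolding pairing_def
    proof (rule integral_mono_AE)
      show "AE p in ?M. - c * h p \<le> \<zeta> p * h p"
        using c by eventually_elim (use h_nn in \<open>intro mult_right_mono, auto\<close>)
    qed (use h_int \<zeta>h in auto)
    also have "\<dots> \<le> (\<integral>p. (e * ln e - u p * ln (u p)) * indicator A p \<partial>?M)"
      using \<zeta>(3)[OF x_L1] by (simp add: ent_x entropy_eq[OF fin])
    also have "\<dots> \<le> (\<integral>p. (- c - 1) * h p \<partial>?M)"
    proof (rule integral_mono_AE)
      show "AE p in ?M. (e * ln e - u p * ln (u p)) * indicator A p \<le> (- c - 1) * h p"
        using u_int(3)
      proof eventually_elim
        case (elim p)
        have "e * ln e - u p * ln (u p) \<le> (ln e + 1) * (e - u p)"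
          using entropy_gradient_ineq[OF elim e(1)] by (simp add: algebra_simps)
        also have "ln e + 1 = - c - 1"
          by (simp add: e(2))
        finally show ?case
          by (simp add: h_def indicator_def)
      qed
    qed (use h_int ln_int in auto)
    also have "\<dots> = (- c - 1) * (\<integral>p. h p \<partial>?M)"
      by simp
    finally have "(\<integral>p. h p \<partial>?M) \<le> 0"
      by (simp add: algebra_simps)
    then have "(\<integral>p. h p \<partial>?M) = 0"
      using h_nn by (intro antisym) simp_all
    then have "AE p in ?M. h p = 0"
      using h_nn h_int by (subst (asm) integral_nonneg_eq_0_iff_AE) auto
    then have "AE p in ?M. p \<notin> A"
      by eventually_elim (use \<open>A \<subseteq> S\<close> in \<open>auto simp: h_def S_def indicator_def split: if_splits\<close>)
    then show ?thesis
      using A AE_iff_null_sets by blast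
  qed
  \<comment> \<open>\<open>S\<close> itself may have infinite measure, so it is exhausted by pieces
    of finite measure.\<close>
  obtain F :: "nat \<Rightarrow> point set" where F: "range F \<subseteq> sets ?M" "(\<Union>i. F i) = space ?M"
    "\<And>i. emeasure ?M (F i) \<noteq> \<infinity>"
    using sigma_finite by metis
  have "S \<inter> F i \<in> null_sets ?M" for i
  proof (rule null)
    show "emeasure ?M (S \<inter> F i) \<noteq> \<infinity>"
      using F emeasure_mono[of "S \<inter> F i" "F i" ?M] by (auto simp: top_unique)
  qed (use F in auto)
  then have "(\<Union>i. S \<inter> F i) \<in> null_sets ?M"
    by (rule null_sets_UN)
  moreover have "(\<Union>i. S \<inter> F i) = S"
    using F(2) by (auto simp: S_def)
  ultimately have "AE x in ?M. x \<notin> S"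
    using AE_not_in by force
  then have "AE x in ?M. e \<le> u x"
    using AE_space by eventually_elim (auto simp: S_def)
  then show ?thesis
    using fin e by (auto simp: interior_simplex_def)
qed

section \<open>Coercivity, convexity and the Bregman distance of \<open>B\<close>\<close>

locale entropic_pdhg_setting = bounded_operator_L1_L2 +
  fixes \<tau> \<sigma> :: real
  assumes \<tau>: "0 < \<tau>" and \<sigma>: "0 < \<sigma>" and step: "\<tau> * \<sigma> * (op_norm \<Omega> \<Gamma> K)\<^sup>2 < 1"
begin

abbreviation B where
  "B \<equiv> B_functional \<Omega> \<Gamma> K \<tau> \<sigma>"

definition \<nu> where
  "\<nu> = 1 / \<sigma> - \<tau> * (op_norm \<Omega> \<Gamma> K)\<^sup>2"

text \<open>A closed form of D_B as a real number: the Bregman distance of each summand of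
  \<open>B\<close> separately, a quadratic or bilinear form being reproduced in the
  differences.\<close>

definition B_distance where
  "B_distance a p b q = rel_entropy \<Omega> a b / \<tau> + (norm2 \<Gamma> (p - q))\<^sup>2 / (2 * \<sigma>) - pairing \<Gamma> (p - q) (K (a - b))"

lemma \<nu>_pos: "0 < \<nu>"
  using step \<sigma> by (simp add: \<nu>_def field_simps)

text \<open>The bilinear term is at most \<open>N * b * a\<close>. Completing the square
  \<open>(a - \<tau> * N * b)^2 / (2 * \<tau>)\<close> absorbs it at the price of
  \<open>\<tau> * N^2 / 2 * b^2\<close>; what remains of \<open>b^2 / (2 * \<sigma>)\<close> is
  \<open>\<nu> / 2 * b^2\<close>.\<close>

lemma coercive:
  assumes "h \<in> L1 \<Omega>" "r \<in> L2 \<Gamma>"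
  shows "\<nu> / 2 * (norm2 \<Gamma> r)\<^sup>2 \<le>
    (norm1 \<Omega> h)\<^sup>2 / (2 * \<tau>) + (norm2 \<Gamma> r)\<^sup>2 / (2 * \<sigma>) - pairing \<Gamma> r (K h)"
proof -
  define N a b where "N = op_norm \<Omega> \<Gamma> K" and "a = norm1 \<Omega> h" and "b = norm2 \<Gamma> r"
  have "0 \<le> (a - \<tau> * N * b)\<^sup>2 / (2 * \<tau>)"
    using \<tau> by simp
  also have "\<dots> = a\<^sup>2 / (2 * \<tau>) - N * b * a + \<tau> * N\<^sup>2 / 2 * b\<^sup>2"
    using \<tau> by (simp add: power2_eq_square field_simps)
  finally have "0 \<le> a\<^sup>2 / (2 * \<tau>) - N * b * a + \<tau> * N\<^sup>2 / 2 * b\<^sup>2" .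
  moreover have "\<nu> / 2 * b\<^sup>2 = b\<^sup>2 / (2 * \<sigma>) - \<tau> * N\<^sup>2 / 2 * b\<^sup>2"
    by (simp add: \<nu>_def N_def algebra_simps diff_divide_distrib)
  moreover have "pairing \<Gamma> r (K h) \<le> N * b * a"
    using abs_pairing_K_le[OF assms(2,1)] by (simp add: N_def a_def b_def)
  ultimately show ?thesis
    unfolding a_def b_def by linarith
qed

lemma B_distance_ge:
  assumes "a \<in> finite_entropy_simplex \<Omega>" "b \<in> interior_simplex \<Omega>" "p \<in> L2 \<Gamma>" "q \<in> L2 \<Gamma>"
  shows "\<nu> / 2 * (norm2 \<Gamma> (p - q))\<^sup>2 \<le> B_distance a p b q"
proof -
  have "(norm1 \<Omega> (a - b))\<^sup>2 / (2 * \<tau>) \<le> rel_entropy \<Omega> a b / \<tau>"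
    using rel_entropy_ge[OF assms(1,2)] \<tau> by (simp add: field_simps)
  moreover have "a - b \<in> L1 \<Omega>" "p - q \<in> L2 \<Gamma>"
    using assms by (simp_all add: L1_diff L2_diff finite_entropy_simplexD interior_simplexD)
  ultimately show ?thesis
    unfolding B_distance_def using coercive[of "a - b" "p - q"] by linarith
qed

lemma B_distance_nonneg:
  assumes "a \<in> finite_entropy_simplex \<Omega>" "b \<in> interior_simplex \<Omega>" "p \<in> L2 \<Gamma>" "q \<in> L2 \<Gamma>"
  shows "0 \<le> B_distance a p b q"
proof -
  have "0 \<le> \<nu> / 2 * (norm2 \<Gamma> (p - q))\<^sup>2"
    using \<nu>_pos by simp
  with B_distance_ge[OF assms] show ?thesis
    by (rule order_trans[rotated])
qed

lemma B_eq:
  "u \<in> finite_entropy_simplex \<Omega> \<Longrightarrow>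
    B (u, v) = ereal (entropy_integral \<Omega> u / \<tau> + (norm2 \<Gamma> v)\<^sup>2 / (2 * \<sigma>) - pairing \<Gamma> v (K u))"
  by (simp add: B_functional_def entropy_eq)

lemma B_eq_infinity:
  "u \<notin> finite_entropy_simplex \<Omega> \<Longrightarrow> u \<in> prob_simplex \<Omega> \<Longrightarrow> B (u, v) = \<infinity>"
  using \<tau> by (simp add: B_functional_def entropy_eq_infinity)

text \<open>The quadratic and bilinear parts have exact convexity gaps and the entropy a gap bounded
  below. Together they amount to at least \<open>t * (1 - t)\<close> times the right-hand side of
  \<open>coercive\<close> at the difference of the two points, which is nonnegative although the
  bilinear gap alone has no sign.\<close>

lemma convex_B: "convex_functional_on (prob_simplex \<Omega> \<times> L2 \<Gamma>) B"
  unfolding convex_functional_on_def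
proof (intro conjI ballI allI impI)
  show "convex (prob_simplex \<Omega> \<times> L2 \<Gamma>)"
    by (intro convex_Times convex_prob_simplex convex_L2)
  fix w w' :: "fn \<times> fn" and t :: real
  assume w: "w \<in> prob_simplex \<Omega> \<times> L2 \<Gamma>" "w' \<in> prob_simplex \<Omega> \<times> L2 \<Gamma>" and t: "0 < t \<and> t < 1"
  obtain x v y v' where ww: "w = (x, v)" "w' = (y, v')"
    by (metis prod.exhaust)
  have simplex: "x \<in> prob_simplex \<Omega>" "y \<in> prob_simplex \<Omega>" and v: "v \<in> L2 \<Gamma>" "v' \<in> L2 \<Gamma>"
    using w by (auto simp: ww)
  show "B ((1 - t) *\<^sub>R w + t *\<^sub>R w') \<le> ereal (1 - t) * B w + ereal t * B w'"
  proof (cases "x \<in> finite_entropy_simplex \<Omega> \<and> y \<in> finite_entropy_simplex \<Omega>")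
    case False
    \<comment> \<open>An endpoint of infinite entropy makes the right-hand side infinite, since
      \<open>B\<close> never takes the value \<open>-\<infinity>\<close> here.\<close>
    have "ereal (1 - t) * B w + ereal t * B w' = \<infinity>"
    proof (cases "x \<in> finite_entropy_simplex \<Omega>")
      case True
      then show ?thesis
        using False t simplex by (simp add: ww B_eq B_eq_infinity)
    next
      case False
      then have "B w = \<infinity>"
        using simplex by (simp add: ww B_eq_infinity)
      then show ?thesis
        using t by simp
    qed
    then show ?thesis
      by (simp only: ereal_less_eq)
  next
    case True
    then have xy: "x \<in> finite_entropy_simplex \<Omega>" "y \<in> finite_entropy_simplex \<Omega>"
      by auto
    note L1 = simplex[THEN prob_simplex_L1]
    define z q where "z = (1 - t) *\<^sub>R x + t *\<^sub>R y" and "q = (1 - t) *\<^sub>R v + t *\<^sub>R v'"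
    have z: "z \<in> finite_entropy_simplex \<Omega>"
      and z_ent: "entropy_integral \<Omega> z + t * (1 - t) / 2 * (norm1 \<Omega> (x - y))\<^sup>2
        \<le> (1 - t) * entropy_integral \<Omega> x + t * entropy_integral \<Omega> y"
      using finite_entropy_simplex_mix[OF xy] t by (simp_all add: z_def)
    have q_norm: "(norm2 \<Gamma> q)\<^sup>2 + t * (1 - t) * (norm2 \<Gamma> (v - v'))\<^sup>2
        = (1 - t) * (norm2 \<Gamma> v)\<^sup>2 + t * (norm2 \<Gamma> v')\<^sup>2"
      using v by (simp add: q_def power2_norm2 pairing_linear L2_add L2_scaleR L2_diff
          pairing_commute[of _ v' v] algebra_simps)
    have Kz: "pairing \<Gamma> r (K z) = (1 - t) * pairing \<Gamma> r (K x) + t * pairing \<Gamma> r (K y)"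
      if "r \<in> L2 \<Gamma>" for r
      using that L1 by (simp add: z_def pairing_K_add pairing_K_scaleR L1_scaleR)
    have q_pairing: "pairing \<Gamma> q (K z) + t * (1 - t) * pairing \<Gamma> (v - v') (K (x - y))
        = (1 - t) * pairing \<Gamma> v (K x) + t * pairing \<Gamma> v' (K y)"
      using v L1
      by (simp add: Kz q_def pairing_K_diff pairing_add_left pairing_diff_left pairing_scaleR_left
          L2_add L2_scaleR L2_diff K_L2 algebra_simps)
    have "0 \<le> \<nu> / 2 * (norm2 \<Gamma> (v - v'))\<^sup>2"
      using \<nu>_pos by simp
    also have "\<dots> \<le> (norm1 \<Omega> (x - y))\<^sup>2 / (2 * \<tau>) + (norm2 \<Gamma> (v - v'))\<^sup>2 / (2 * \<sigma>)
        - pairing \<Gamma> (v - v') (K (x - y))"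
      using coercive[of "x - y" "v - v'"] L1 v by (simp add: L1_diff L2_diff)
    finally have "0 \<le> t * (1 - t) * ((norm1 \<Omega> (x - y))\<^sup>2 / (2 * \<tau>)
        + (norm2 \<Gamma> (v - v'))\<^sup>2 / (2 * \<sigma>) - pairing \<Gamma> (v - v') (K (x - y)))"
      using t by simp
    also have "\<dots> = (t * (1 - t) / 2 * (norm1 \<Omega> (x - y))\<^sup>2) / \<tau>
        + (t * (1 - t) * (norm2 \<Gamma> (v - v'))\<^sup>2) / (2 * \<sigma>) - t * (1 - t) * pairing \<Gamma> (v - v') (K (x - y))"
      by (simp add: field_simps)
    finally have gap: "0 \<le> \<dots>" .
    have "entropy_integral \<Omega> z / \<tau> + (norm2 \<Gamma> q)\<^sup>2 / (2 * \<sigma>) - pairing \<Gamma> q (K z)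
      \<le> (entropy_integral \<Omega> z + t * (1 - t) / 2 * (norm1 \<Omega> (x - y))\<^sup>2) / \<tau>
        + ((norm2 \<Gamma> q)\<^sup>2 + t * (1 - t) * (norm2 \<Gamma> (v - v'))\<^sup>2) / (2 * \<sigma>)
        - (pairing \<Gamma> q (K z) + t * (1 - t) * pairing \<Gamma> (v - v') (K (x - y)))"
      using gap by (simp add: add_divide_distrib)
    also have "\<dots> \<le> ((1 - t) * entropy_integral \<Omega> x + t * entropy_integral \<Omega> y) / \<tau>
        + ((1 - t) * (norm2 \<Gamma> v)\<^sup>2 + t * (norm2 \<Gamma> v')\<^sup>2) / (2 * \<sigma>)
        - ((1 - t) * pairing \<Gamma> v (K x) + t * pairing \<Gamma> v' (K y))"
      unfolding q_norm q_pairing using divide_right_mono[OF z_ent, of \<tau>] \<tau> by simp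
    also have "\<dots> = (1 - t) * (entropy_integral \<Omega> x / \<tau> + (norm2 \<Gamma> v)\<^sup>2 / (2 * \<sigma>) - pairing \<Gamma> v (K x))
        + t * (entropy_integral \<Omega> y / \<tau> + (norm2 \<Gamma> v')\<^sup>2 / (2 * \<sigma>) - pairing \<Gamma> v' (K y))"
      by (simp add: algebra_simps add_divide_distrib diff_divide_distrib)
    finally show ?thesis
      by (simp add: ww B_eq[OF z] B_eq[OF xy(1)] B_eq[OF xy(2)] flip: z_def q_def)
  qed
qed

text \<open>By convexity each pointwise difference quotient lies between the derivative
  \<open>g\<close> and the chord \<open>a * ln a - b * ln b\<close>. Both are integrable, so limit
  and integral commute. In the integral of \<open>g\<close> the part \<open>a - b\<close> drops out
  because both masses are 1.\<close>

lemma tendsto_entropy_quotient: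
  assumes a: "a \<in> finite_entropy_simplex \<Omega>" and b: "b \<in> interior_simplex \<Omega>"
  shows "((\<lambda>t. (entropy_integral \<Omega> (b + t *\<^sub>R (a - b)) - entropy_integral \<Omega> b) / t) \<longlongrightarrow>
    (\<integral>x. a x * ln (b x) \<partial>lebesgue_on \<Omega>) - entropy_integral \<Omega> b) (at_right 0)"
proof -
  let ?M = "lebesgue_on \<Omega>"
  note a' = finite_entropy_simplexD[OF a] and b' = interior_simplexD[OF b]
  note a_int = prob_simplexD[OF a'(1)] and b_int = prob_simplexD[OF b'(2)]
  note b_ln = finite_entropy_simplexD(3)[OF b'(1)] and ab_ln = integrable_mult_ln_interior[OF a b]
  note [measurable] = borel_measurable_integrable[OF a_int(1)] borel_measurable_integrable[OF b_int(1)]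
  define z where "z t x = b x + t * (a x - b x)" for t x
  define q where "q t x = (z t x * ln (z t x) - b x * ln (b x)) / t" for t x
  define g where "g x = (1 + ln (b x)) * (a x - b x)" for x
  have g_int: "integrable ?M g"
    using a_int(1) b_int(1) b_ln ab_ln by (simp add: g_def[abs_def] algebra_simps)
  have "((\<lambda>t. \<integral>x. q t x \<partial>?M) \<longlongrightarrow> (\<integral>x. g x \<partial>?M)) (at_right 0)"
  proof (rule tendsto_at_right_sequentially[of 0 1])
    \<comment> \<open>Dominated convergence is applied along arbitrary sequences tending to 0 from
      the right.\<close>
    fix s :: "nat \<Rightarrow> real"
    assume s: "\<And>n. 0 < s n" "\<And>n. s n < 1" "s \<longlonglongrightarrow> 0"
    show "(\<lambda>n. \<integral>x. q (s n) x \<partial>?M) \<longlonglongrightarrow> (\<integral>x. g x \<partial>?M)"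
    proof (rule integral_dominated_convergence
        [where w = "\<lambda>x. \<bar>g x\<bar> + \<bar>a x * ln (a x)\<bar> + \<bar>b x * ln (b x)\<bar>"])
      show "AE x in ?M. (\<lambda>n. q (s n) x) \<longlonglongrightarrow> g x"
        using interior_simplex_pos[OF b]
      proof eventually_elim
        case (elim x)
        have "((\<lambda>t. z t x * ln (z t x)) has_real_derivative g x) (at 0)"
          unfolding z_def g_def using elim
          by (auto intro!: derivative_eq_intros simp: field_simps)
        then have "((\<lambda>t. q t x) \<longlongrightarrow> g x) (at 0)"
          by (simp add: DERIV_def q_def z_def)
        then show ?case
          by (rule filterlim_compose) (simp add: filterlim_at s less_imp_neq[OF s(1), symmetric])
      qed
      fix n
      show "AE x in ?M. norm (q (s n) x) \<le> \<bar>g x\<bar> + \<bar>a x * ln (a x)\<bar> + \<bar>b x * ln (b x)\<bar>"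
        using interior_simplex_pos[OF b] a_int(3)
      proof eventually_elim
        case (elim x)
        have t: "0 < s n" "s n < 1"
          using s by auto
        have z: "z (s n) x = (1 - s n) * b x + s n * a x"
          by (simp add: z_def algebra_simps)
        have z_pos: "0 < z (s n) x"
          unfolding z using t elim by (intro add_pos_nonneg) auto
        have "s n * g x \<le> z (s n) x * ln (z (s n) x) - b x * ln (b x)"
          using entropy_gradient_ineq[of "z (s n) x" "b x"] z_pos elim
          by (simp add: g_def z_def algebra_simps)
        then have lower: "g x \<le> q (s n) x"
          using t by (simp add: q_def pos_le_divide_eq mult.commute)
        \<comment> \<open>Tangent inequalities at the intermediate point, evaluated at both ends; in
          the weighted sum the linear parts cancel and the chord bound remains.\<close>
        have "(1 - s n) * (b x - z (s n) x) + s n * (a x - z (s n) x)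
            \<le> (1 - s n) * (b x * ln (b x) - b x * ln (z (s n) x))
              + s n * (a x * ln (a x) - a x * ln (z (s n) x))"
          using t z_pos elim by (intro add_mono mult_left_mono entropy_gradient_ineq) auto
        also have "(1 - s n) * (b x - z (s n) x) + s n * (a x - z (s n) x) = 0"
          by (simp add: z algebra_simps)
        also have "(1 - s n) * (b x * ln (b x) - b x * ln (z (s n) x))
              + s n * (a x * ln (a x) - a x * ln (z (s n) x))
            = s n * (a x * ln (a x) - b x * ln (b x)) - (z (s n) x * ln (z (s n) x) - b x * ln (b x))"
          by (simp add: z algebra_simps)
        finally have "q (s n) x \<le> a x * ln (a x) - b x * ln (b x)"
          using t by (simp add: q_def pos_divide_le_eq mult.commute)
        with lower show ?case
          by simp
      qed
    qed (use g_int a'(3) b_ln in \<open>auto simp: q_def[abs_def] z_def[abs_def]\<close>)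
  qed simp
  moreover have "(\<integral>x. g x \<partial>?M) = (\<integral>x. a x * ln (b x) \<partial>?M) - entropy_integral \<Omega> b"
    using a_int b_int b_ln ab_ln by (simp add: g_def algebra_simps entropy_integral_def)
  moreover have "eventually (\<lambda>t. (\<integral>x. q t x \<partial>?M)
      = (entropy_integral \<Omega> (b + t *\<^sub>R (a - b)) - entropy_integral \<Omega> b) / t) (at_right 0)"
    unfolding eventually_at_right_field
  proof (intro exI[of _ 1] conjI allI impI)
    fix t :: real
    assume t: "0 < t" "t < 1"
    have eq: "b + t *\<^sub>R (a - b) = (1 - t) *\<^sub>R b + t *\<^sub>R a"
      by (simp add: algebra_simps)
    have "z t = b + t *\<^sub>R (a - b)"
      by (simp add: z_def scaleR_fun_def fun_eq_iff)
    then have "integrable ?M (\<lambda>x. z t x * ln (z t x))"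
      using finite_entropy_simplexD(3)[OF finite_entropy_simplex_mix(1)[OF b'(1) a t]]
      by (simp only: eq)
    then show "(\<integral>x. q t x \<partial>?M)
        = (entropy_integral \<Omega> (b + t *\<^sub>R (a - b)) - entropy_integral \<Omega> b) / t"
      using b_ln by (simp add: q_def z_def entropy_integral_def scaleR_fun_def)
  qed simp
  ultimately show ?thesis
    by (simp add: tendsto_cong)
qed

text \<open>Along the segment the quotient of \<open>B\<close> is the entropy quotient plus an
  affine function of \<open>t\<close>, so its limit is explicit. For small \<open>t\<close> every
  value of \<open>B\<close> involved is finite, which reduces the limit to one of reals.\<close>

lemma bregman_dd_B_eq:
  assumes a: "a \<in> finite_entropy_simplex \<Omega>" and b: "b \<in> interior_simplex \<Omega>"
    and p: "p \<in> L2 \<Gamma>" and q: "q \<in> L2 \<Gamma>"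
  shows "bregman_dd B (a, p) (b, q) = ereal (B_distance a p b q)"
proof -
  note a' = finite_entropy_simplexD[OF a] and b' = interior_simplexD[OF b]
  define h r where "h = a - b" and "r = p - q"
  have L: "h \<in> L1 \<Omega>" "r \<in> L2 \<Gamma>" "a \<in> L1 \<Omega>" "b \<in> L1 \<Omega>" "K h \<in> L2 \<Gamma>" "K b \<in> L2 \<Gamma>" "K a \<in> L2 \<Gamma>"
    using a' b' p q by (simp_all add: h_def r_def L1_diff L2_diff K_L2)
  define e where "e t = (entropy_integral \<Omega> (b + t *\<^sub>R h) - entropy_integral \<Omega> b) / t" for t
  define e' where "e' = (\<integral>x. a x * ln (b x) \<partial>lebesgue_on \<Omega>) - entropy_integral \<Omega> b"
  define f where "f t = e t / \<tau> + (2 * pairing \<Gamma> q r + t * (norm2 \<Gamma> r)\<^sup>2) / (2 * \<sigma>)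
      - (pairing \<Gamma> q (K h) + pairing \<Gamma> r (K b) + t * pairing \<Gamma> r (K h))" for t
  \<comment> \<open>The summands with factor 0 are kept so that \<open>d\<close> is the termwise
    limit of \<open>f\<close>.\<close>
  define d where "d = e' / \<tau> + (2 * pairing \<Gamma> q r + 0 * (norm2 \<Gamma> r)\<^sup>2) / (2 * \<sigma>)
      - (pairing \<Gamma> q (K h) + pairing \<Gamma> r (K b) + 0 * pairing \<Gamma> r (K h))"
  have "(e \<longlongrightarrow> e') (at_right 0)"
    unfolding e_def[abs_def] e'_def h_def by (rule tendsto_entropy_quotient[OF a b])
  then have "(f \<longlongrightarrow> d) (at_right 0)"
    unfolding f_def[abs_def] d_def using \<tau> \<sigma> by (intro tendsto_intros) auto
  moreover have "eventually (\<lambda>t. ereal (f t) = (B ((b, q) + t *\<^sub>R ((a, p) - (b, q))) - B (b, q)) / ereal t)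
      (at_right 0)"
    unfolding eventually_at_right_field
  proof (intro exI[of _ 1] conjI allI impI)
    fix t :: real
    assume t: "0 < t" "t < 1"
    have "b + t *\<^sub>R h = (1 - t) *\<^sub>R b + t *\<^sub>R a"
      by (simp add: h_def algebra_simps)
    then have bt: "b + t *\<^sub>R h \<in> finite_entropy_simplex \<Omega>"
      using finite_entropy_simplex_mix(1)[OF b'(1) a t] by simp
    have "(b, q) + t *\<^sub>R ((a, p) - (b, q)) = (b + t *\<^sub>R h, q + t *\<^sub>R r)"
      by (simp add: h_def r_def)
    moreover have "(entropy_integral \<Omega> (b + t *\<^sub>R h) / \<tau> + (norm2 \<Gamma> (q + t *\<^sub>R r))\<^sup>2 / (2 * \<sigma>)
          - pairing \<Gamma> (q + t *\<^sub>R r) (K (b + t *\<^sub>R h))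
        - (entropy_integral \<Omega> b / \<tau> + (norm2 \<Gamma> q)\<^sup>2 / (2 * \<sigma>) - pairing \<Gamma> q (K b))) / t = f t"
    proof -
      have "pairing \<Gamma> (q + t *\<^sub>R r) (K (b + t *\<^sub>R h))
          = pairing \<Gamma> q (K b) + t * (pairing \<Gamma> q (K h) + pairing \<Gamma> r (K b) + t * pairing \<Gamma> r (K h))"
        using L q by (simp add: pairing_K_add pairing_K_scaleR pairing_add_left pairing_scaleR_left
            L1_scaleR L2_scaleR L2_add K_L2 L1_add algebra_simps)
      moreover have "entropy_integral \<Omega> (b + t *\<^sub>R h) = entropy_integral \<Omega> b + t * e t"
        using t by (simp add: e_def)
      ultimately show ?thesis
        using t \<tau> \<sigma> power2_norm2_add_scaleR[OF q L(2), of t]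
        by (simp add: f_def field_simps power2_eq_square[of t])
    qed
    ultimately show "ereal (f t) = (B ((b, q) + t *\<^sub>R ((a, p) - (b, q))) - B (b, q)) / ereal t"
      using t by (simp add: B_eq[OF bt] B_eq[OF b'(1)])
  qed simp
  ultimately have "((\<lambda>t. (B ((b, q) + t *\<^sub>R ((a, p) - (b, q))) - B (b, q)) / ereal t) \<longlongrightarrow> ereal d) (at_right 0)"
    by (auto elim!: tendsto_cong[THEN iffD1])
  then have "directional_derivative B (b, q) ((a, p) - (b, q)) = ereal d"
    unfolding directional_derivative_def by (intro tendsto_Lim) auto
  moreover have "rel_entropy \<Omega> a b = entropy_integral \<Omega> a - entropy_integral \<Omega> b - e'"
    by (simp add: rel_entropy_eq[OF a b] e'_def)
  moreover have "(norm2 \<Gamma> p)\<^sup>2 = (norm2 \<Gamma> q)\<^sup>2 + 2 * pairing \<Gamma> q r + (norm2 \<Gamma> r)\<^sup>2"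
    using power2_norm2_add_scaleR[OF q L(2), of 1] by (simp add: r_def)
  moreover have "pairing \<Gamma> p (K a) = pairing \<Gamma> q (K b) + pairing \<Gamma> q (K h) + pairing \<Gamma> r (K b) + pairing \<Gamma> r (K h)"
    using L p q by (simp add: h_def r_def pairing_K_diff pairing_diff_left)
  ultimately show ?thesis
    by (simp add: bregman_dd_def B_eq[OF a] B_eq[OF b'(1)] B_distance_def d_def
        add_divide_distrib diff_divide_distrib flip: h_def r_def)
qed

text \<open>Whatever the directional derivative is, subtracting it from \<open>\<infinity>\<close>
  leaves \<open>\<infinity>\<close>.\<close>

lemma bregman_dd_B_eq_infinity:
  assumes "a \<notin> finite_entropy_simplex \<Omega>" "a \<in> prob_simplex \<Omega>" "b \<in> finite_entropy_simplex \<Omega>"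
  shows "bregman_dd B (a, p) (b, q) = \<infinity>"
  using assms by (simp add: bregman_dd_def B_eq B_eq_infinity minus_ereal_def)

end

section \<open>The iteration\<close>

lemma conjugate_L2_leI:
  assumes "proper_on (L2 S) H"
    and "\<And>z h. z \<in> L2 S \<Longrightarrow> H z = ereal h \<Longrightarrow> pairing S v z - h \<le> c"
  shows "conjugate_L2 S H v \<le> ereal c"
  unfolding conjugate_L2_def
proof (rule SUP_least)
  fix z
  assume z: "z \<in> L2 S"
  show "ereal (pairing S v z) - H z \<le> ereal c"
    using assms z by (cases "H z") (auto simp: proper_on_def)
qed

lemma pairing_le_conjugate_L2:
  assumes "z \<in> L2 S" "H z = ereal h" "conjugate_L2 S H v = ereal c"
  shows "pairing S v z - h \<le> c"
  using SUP_upper[OF assms(1), of "\<lambda>z. ereal (pairing S v z) - H z"] assms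
  by (simp add: conjugate_L2_def)

lemma conjugate_L2_mix:
  assumes H: "proper_on (L2 S) H"
    and v: "v \<in> L2 S" "w \<in> L2 S" "conjugate_L2 S H v = ereal a" "conjugate_L2 S H w = ereal b"
    and t: "0 < t" "t < 1"
  shows "conjugate_L2 S H ((1 - t) *\<^sub>R v + t *\<^sub>R w) \<le> ereal ((1 - t) * a + t * b)"
proof (rule conjugate_L2_leI[OF H])
  fix z h
  assume z: "z \<in> L2 S" "H z = ereal h"
  have "(1 - t) * (pairing S v z - h) + t * (pairing S w z - h) \<le> (1 - t) * a + t * b"
    using z v t by (intro add_mono mult_left_mono pairing_le_conjugate_L2) auto
  moreover have "pairing S ((1 - t) *\<^sub>R v + t *\<^sub>R w) z = (1 - t) * pairing S v z + t * pairing S w z"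
    using z v by (simp add: pairing_add_left pairing_scaleR_left L2_scaleR)
  ultimately show "pairing S ((1 - t) *\<^sub>R v + t *\<^sub>R w) z - h \<le> (1 - t) * a + t * b"
    by (simp add: algebra_simps)
qed

lemma L2_zero: "0 \<in> L2 S"
  by (simp add: L2_def zero_fun_def)

lemma L2_sum: "(\<And>k. k \<in> I \<Longrightarrow> v k \<in> L2 S) \<Longrightarrow> (\<Sum>k\<in>I. v k) \<in> L2 S"
  by (induction I rule: infinite_finite_induct) (auto simp: L2_zero intro: L2_add)

lemma L1_sum: "(\<And>k. k \<in> I \<Longrightarrow> v k \<in> L1 S) \<Longrightarrow> (\<Sum>k\<in>I. v k) \<in> L1 S"
  by (induction I rule: infinite_finite_induct) (auto simp: L1_iff zero_fun_def plus_fun_def)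

lemma pairing_sum_left:
  assumes "z \<in> L2 S" "\<And>k. k \<in> I \<Longrightarrow> v k \<in> L2 S"
  shows "pairing S (\<Sum>k\<in>I. v k) z = (\<Sum>k\<in>I. pairing S (v k) z)"
  using assms(2)
proof (induction I rule: infinite_finite_induct)
  case (insert k I)
  then show ?case
    using assms(1) pairing_add_left[of "v k" S "\<Sum>k\<in>I. v k" z] L2_sum[of I v S]
    by (simp add: plus_fun_def)
qed (simp_all add: pairing_def)

lemma pairing_ergodic_mean_left:
  assumes "z \<in> L2 S" "\<And>k. 1 \<le> k \<Longrightarrow> v k \<in> L2 S"
  shows "pairing S (ergodic_mean v n) z = (\<Sum>k = 1..n. pairing S (v k) z) / real n"
  using assms pairing_sum_left[of z S "{1..n}" v] by (simp add: ergodic_mean_def pairing_scaleR_left)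

lemma ergodic_mean_L2: "(\<And>k. 1 \<le> k \<Longrightarrow> v k \<in> L2 S) \<Longrightarrow> ergodic_mean v n \<in> L2 S"
  unfolding ergodic_mean_def by (intro L2_scaleR L2_sum) simp

text \<open>Jensen's inequality read off the supremum: for each \<open>z\<close> the affine term at
  the mean is the mean of the affine terms.\<close>

lemma conjugate_L2_ergodic_mean:
  assumes H: "proper_on (L2 S) H" and "1 \<le> n"
    and v: "\<And>k. 1 \<le> k \<Longrightarrow> v k \<in> L2 S" "\<And>k. 1 \<le> k \<Longrightarrow> conjugate_L2 S H (v k) = ereal (a k)"
  shows "conjugate_L2 S H (ergodic_mean v n) \<le> ereal ((\<Sum>k = 1..n. a k) / real n)"
proof (rule conjugate_L2_leI[OF H])
  fix z h
  assume z: "z \<in> L2 S" "H z = ereal h"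
  have "(\<Sum>k = 1..n. pairing S (v k) z - h) \<le> (\<Sum>k = 1..n. a k)"
    by (intro sum_mono pairing_le_conjugate_L2[OF z v(2)]) simp
  then have "(\<Sum>k = 1..n. pairing S (v k) z - h) / real n \<le> (\<Sum>k = 1..n. a k) / real n"
    by (rule divide_right_mono) simp
  then show "pairing S (ergodic_mean v n) z - h \<le> (\<Sum>k = 1..n. a k) / real n"
    using \<open>1 \<le> n\<close> pairing_ergodic_mean_left[where n = n and v = v, OF z(1) v(1)]
    by (simp add: sum_subtractf diff_divide_distrib)
qed

lemma ergodic_mean_in_convex:
  assumes "convex A" "1 \<le> n" "\<And>k. 1 \<le> k \<Longrightarrow> x k \<in> A"
  shows "ergodic_mean x n \<in> A"
  unfolding ergodic_mean_def scaleR_sum_right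
  using assms by (intro convex_sum) auto

text \<open>The minimiser \<open>p\<close> is compared with points on the segment to
  \<open>z\<close>: convexity of the conjugate and expansion of the square give an inequality
  divisible by \<open>t\<close>, and \<open>t\<close> then tends to 0. The outcome says that
  \<open>(x - p) / \<sigma>\<close> is a subgradient at \<open>p\<close>.\<close>

lemma prox_variational_ineq:
  assumes H: "proper_on (L2 S) H" and "0 < \<sigma>"
    and p: "p \<in> prox S \<sigma> (conjugate_L2 S H) x" and L2: "x \<in> L2 S" "z \<in> L2 S"
    and fin: "conjugate_L2 S H p = ereal a" "conjugate_L2 S H z = ereal b"
  shows "a - b \<le> pairing S (x - p) (p - z) / \<sigma>"
proof -
  have pL2: "p \<in> L2 S" and min: "\<And>y. y \<in> L2 S \<Longrightarrow>
      conjugate_L2 S H p + ereal (1 / (2 * \<sigma>) * (norm2 S (p - x))\<^sup>2)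
      \<le> conjugate_L2 S H y + ereal (1 / (2 * \<sigma>) * (norm2 S (y - x))\<^sup>2)"
    using p by (auto simp: prox_def)
  define c m r where "c = pairing S (p - x) (z - p)" and "m = (norm2 S (z - p))\<^sup>2"
    and "r = 1 / (2 * \<sigma>)"
  have est: "a - b \<le> 2 * r * c + t * (r * m)" if t: "0 < t" "t < 1" for t
  proof -
    define y where "y = (1 - t) *\<^sub>R p + t *\<^sub>R z"
    have y: "y \<in> L2 S"
      unfolding y_def using pL2 L2 by (intro L2_add L2_scaleR)
    have yx: "y - x = (p - x) + t *\<^sub>R (z - p)"
      by (simp add: y_def algebra_simps)
    have "(norm2 S (y - x))\<^sup>2 = (norm2 S (p - x))\<^sup>2 + 2 * t * c + t\<^sup>2 * m"
      unfolding yx c_def m_def using pL2 L2 by (intro power2_norm2_add_scaleR L2_diff)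
    moreover have "ereal a + ereal (r * (norm2 S (p - x))\<^sup>2)
        \<le> ereal ((1 - t) * a + t * b) + ereal (r * (norm2 S (y - x))\<^sup>2)"
      using min[OF y] add_right_mono[OF conjugate_L2_mix[OF H pL2 L2(2) fin t]]
      unfolding fin(1) y_def[symmetric] r_def by (rule order_trans)
    ultimately have "t * (a - b) \<le> t * (2 * r * c + t * (r * m))"
      by (simp add: algebra_simps power2_eq_square[of t])
    then show ?thesis
      using t by simp
  qed
  have "((\<lambda>t. 2 * r * c + t * (r * m)) \<longlongrightarrow> 2 * r * c + 0 * (r * m)) (at_right 0)"
    by (intro tendsto_intros)
  then have "a - b \<le> 2 * r * c + 0 * (r * m)"
  proof (rule tendsto_lowerbound)
    show "eventually (\<lambda>t. a - b \<le> 2 * r * c + t * (r * m)) (at_right 0)"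
      using est by (auto simp: eventually_at_right_field intro!: exI[of _ 1])
  qed simp
  moreover have "c = pairing S (x - p) (p - z)"
    using pL2 L2 by (simp add: c_def pairing_linear L2_diff)
  ultimately show ?thesis
    by (simp add: r_def)
qed

lemma conjugate_L2_indicator:
  assumes "f \<in> L2 S" "v \<in> L2 S"
  shows "conjugate_L2 S (indicator_functional (class_L2 S f)) v = ereal (pairing S v f)"
  unfolding conjugate_L2_def
proof (rule antisym)
  show "(SUP z\<in>L2 S. ereal (pairing S v z) - indicator_functional (class_L2 S f) z) \<le> ereal (pairing S v f)"
  proof (rule SUP_least)
    fix z
    assume "z \<in> L2 S"
    show "ereal (pairing S v z) - indicator_functional (class_L2 S f) z \<le> ereal (pairing S v f)"
      using pairing_cong_AE_L2[OF assms(2) \<open>z \<in> L2 S\<close> assms(1)]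
      by (auto simp: indicator_functional_def class_L2_def)
  qed
  have "f \<in> class_L2 S f"
    using assms by (simp add: class_L2_def)
  then show "ereal (pairing S v f) \<le> (SUP z\<in>L2 S. ereal (pairing S v z) - indicator_functional (class_L2 S f) z)"
    using SUP_upper[OF assms(1), of "\<lambda>z. ereal (pairing S v z) - indicator_functional (class_L2 S f) z"]
    by (simp add: indicator_functional_def)
qed

text \<open>The conjugate is the linear functional given by \<open>f\<close>, so the subgradient
  inequality at \<open>v + q\<close> and at \<open>v - q\<close> forces equality.\<close>

lemma subgradient_conjugate_indicator:
  assumes f: "f \<in> L2 S" and q: "q \<in> L2 S"
    and \<zeta>: "\<zeta> \<in> subdiff_L2 S (conjugate_L2 S (indicator_functional (class_L2 S f))) v"
  shows "pairing S \<zeta> q = pairing S f q"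
proof -
  have L2: "\<zeta> \<in> L2 S" "v \<in> L2 S" and ineq: "\<And>x. x \<in> L2 S \<Longrightarrow>
      conjugate_L2 S (indicator_functional (class_L2 S f)) v + ereal (pairing S \<zeta> (x - v))
      \<le> conjugate_L2 S (indicator_functional (class_L2 S f)) x"
    using \<zeta> by (auto simp: subdifferential_def)
  have le: "pairing S \<zeta> y \<le> pairing S f y" if "y \<in> L2 S" for y
    using ineq[of "v + y"] L2 f that
    by (simp add: conjugate_L2_indicator L2_add pairing_add_left pairing_commute[of S y f])
  show ?thesis
    using le[OF q] le[OF L2_scaleR[OF q, of "- 1"]] unfolding pairing_scaleR_right by linarith
qed

context entropic_pdhg_setting
begin

text \<open>The exponential factor lies between two positive constants, so lower bound and finite
  entropy are inherited. In logarithms the update is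
  \<open>ln u' = ln u - \<tau> * g - ln Z\<close>. Inserted into the three relative entropies, this
  leaves only the pairing with \<open>g\<close>: \<open>ln Z\<close> is multiplied by the integral
  of \<open>u' - a\<close>, which is zero.\<close>

lemma entropic_step:
  assumes u: "u \<in> interior_simplex \<Omega>" and v: "v \<in> L2 \<Gamma>" and "u' \<in> L1 \<Omega>"
    and u': "AE x in lebesgue_on \<Omega>. u' x = u x * exp (- \<tau> * adjoint_op \<Omega> \<Gamma> K v x) /
      (\<integral>y. u y * exp (- \<tau> * adjoint_op \<Omega> \<Gamma> K v y) \<partial>lebesgue_on \<Omega>)"
  shows "u' \<in> interior_simplex \<Omega>"
    and "a \<in> finite_entropy_simplex \<Omega> \<Longrightarrow>
      rel_entropy \<Omega> a u - rel_entropy \<Omega> a u' - rel_entropy \<Omega> u' u = \<tau> * pairing \<Gamma> v (K (u' - a))"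
proof -
  let ?M = "lebesgue_on \<Omega>"
  define g where "g = adjoint_op \<Omega> \<Gamma> K v"
  have "g \<in> Linf \<Omega>"
    unfolding g_def by (rule adjoint_op[OF v])
  then obtain c where c: "AE x in ?M. \<bar>g x\<bar> \<le> c" and [measurable]: "g \<in> borel_measurable ?M"
    by (auto simp: Linf_def)
  note ui = interior_simplexD[OF u]
  note u_int = prob_simplexD[OF ui(2)] and u_ln = finite_entropy_simplexD(3)[OF ui(1)]
  note [measurable] = borel_measurable_integrable[OF u_int(1)]
  have u'_int: "integrable ?M u'"
    using \<open>u' \<in> L1 \<Omega>\<close> by (simp add: L1_iff)
  note [measurable] = borel_measurable_integrable[OF u'_int]
  obtain l where l: "0 < l" "AE x in ?M. l \<le> u x"
    using u by (auto simp: interior_simplex_def)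
  define Z where "Z = (\<integral>y. u y * exp (- \<tau> * g y) \<partial>?M)"
  have exp_bounds: "AE x in ?M. exp (- \<tau> * c) \<le> exp (- \<tau> * g x) \<and> exp (- \<tau> * g x) \<le> exp (\<tau> * c)"
    using c
  proof eventually_elim
    case (elim x)
    have "\<tau> * g x \<le> \<tau> * c" "- (\<tau> * g x) \<le> \<tau> * c"
      using elim \<tau> mult_left_mono[of "g x" c \<tau>] mult_left_mono[of "- g x" c \<tau>] by auto
    then show ?case
      by simp
  qed
  have Z_int: "integrable ?M (\<lambda>x. u x * exp (- \<tau> * g x))"
  proof (rule Bochner_Integration.integrable_bound)
    show "integrable ?M (\<lambda>x. u x * exp (\<tau> * c))"
      using u_int by simp
    show "AE x in ?M. norm (u x * exp (- \<tau> * g x)) \<le> norm (u x * exp (\<tau> * c))"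
      using exp_bounds by eventually_elim (auto simp: abs_mult intro!: mult_left_mono)
  qed measurable
  \<comment> \<open>As \<open>u\<close> has mass 1, the lower bound of the exponential factor is
    also one for the normalising constant.\<close>
  have "exp (- \<tau> * c) = (\<integral>x. u x * exp (- \<tau> * c) \<partial>?M)"
    using u_int by simp
  also have "\<dots> \<le> Z"
    unfolding Z_def
  proof (rule integral_mono_AE)
    show "AE x in ?M. u x * exp (- \<tau> * c) \<le> u x * exp (- \<tau> * g x)"
      using exp_bounds u_int(3) by eventually_elim (intro mult_left_mono, auto)
  qed (use u_int Z_int in auto)
  finally have Z: "0 < Z"
    by (rule less_le_trans[rotated]) simp
  have u'_eq: "AE x in ?M. u' x = u x * exp (- \<tau> * g x) / Z"
    using u' by (simp add: Z_def g_def)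
  have u'_one: "(\<integral>x. u' x \<partial>?M) = 1"
  proof -
    have "(\<integral>x. u' x \<partial>?M) = (\<integral>x. u x * exp (- \<tau> * g x) / Z \<partial>?M)"
      using u'_eq by (intro integral_cong_AE) auto
    then show ?thesis
      using Z by (simp add: Z_def)
  qed
  have ln_u': "AE x in ?M. ln (u' x) = ln (u x) - \<tau> * g x - ln Z"
    using u'_eq l(2) by eventually_elim (use l(1) Z in \<open>simp add: ln_mult ln_div\<close>)
  define D where "D = exp (\<tau> * c) / Z"
  have u'_ln: "integrable ?M (\<lambda>x. u' x * ln (u' x))"
  proof (rule Bochner_Integration.integrable_bound)
    show "integrable ?M (\<lambda>x. D * \<bar>u x * ln (u x)\<bar> + D * (\<tau> * c + \<bar>ln Z\<bar>) * \<bar>u x\<bar>)"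
      using u_int u_ln by simp
    show "AE x in ?M. norm (u' x * ln (u' x)) \<le> norm (D * \<bar>u x * ln (u x)\<bar> + D * (\<tau> * c + \<bar>ln Z\<bar>) * \<bar>u x\<bar>)"
      using u'_eq ln_u' u_int(3) exp_bounds c
    proof eventually_elim
      case (elim x)
      have "u x * exp (- \<tau> * g x) / Z \<le> u x * exp (\<tau> * c) / Z"
        using elim Z by (intro divide_right_mono mult_left_mono) auto
      then have "\<bar>u' x\<bar> \<le> D * \<bar>u x\<bar>"
        using elim(1,3) Z by (simp add: D_def mult.commute)
      moreover have "\<bar>\<tau> * g x\<bar> \<le> \<tau> * c"
        using elim(5) \<tau> by (simp add: abs_mult)
      then have "\<bar>ln (u' x)\<bar> \<le> \<bar>ln (u x)\<bar> + (\<tau> * c + \<bar>ln Z\<bar>)"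
        unfolding elim(2) by linarith
      ultimately have "\<bar>u' x\<bar> * \<bar>ln (u' x)\<bar> \<le> D * \<bar>u x\<bar> * (\<bar>ln (u x)\<bar> + (\<tau> * c + \<bar>ln Z\<bar>))"
        using Z by (intro mult_mono) (auto simp: D_def)
      then have "\<bar>u' x * ln (u' x)\<bar> \<le> D * \<bar>u x * ln (u x)\<bar> + D * (\<tau> * c + \<bar>ln Z\<bar>) * \<bar>u x\<bar>"
        by (simp add: abs_mult algebra_simps)
      then show ?case
        unfolding real_norm_def by (rule order_trans[OF _ abs_ge_self])
    qed
  qed measurable
  have u'_low: "AE x in ?M. l * exp (- \<tau> * c) / Z \<le> u' x"
    using u'_eq l(2) exp_bounds
    by eventually_elim (use l(1) Z in \<open>auto intro!: divide_right_mono mult_mono\<close>)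
  have low_pos: "0 < l * exp (- \<tau> * c) / Z"
    using l Z by simp
  have "AE x in ?M. 0 \<le> u' x"
    using u'_low by eventually_elim (use low_pos in simp)
  then have u'_fin: "u' \<in> finite_entropy_simplex \<Omega>"
    using u'_int u'_one u'_ln by (simp add: finite_entropy_simplex_def prob_simplex_def L1_iff)
  then show interior: "u' \<in> interior_simplex \<Omega>"
    using u'_low low_pos unfolding interior_simplex_def by blast
  assume a: "a \<in> finite_entropy_simplex \<Omega>"
  note a_simplex = finite_entropy_simplexD(1)[OF a]
  note a_int = prob_simplexD[OF a_simplex]
  note [measurable] = borel_measurable_integrable[OF a_int(1)]
  note lns = integrable_mult_ln_interior[OF a u] integrable_mult_ln_interior[OF a interior]
    integrable_mult_ln_interior[OF u'_fin u]
  have diff_L1: "u' - a \<in> L1 \<Omega>"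
    using \<open>u' \<in> L1 \<Omega>\<close> prob_simplex_L1[OF a_simplex] by (rule L1_diff)
  have g_int: "integrable ?M (\<lambda>x. g x * (u' x - a x))"
  proof (rule Bochner_Integration.integrable_bound)
    show "integrable ?M (\<lambda>x. c * (u' x - a x))"
      using u'_int a_int by simp
    show "AE x in ?M. norm (g x * (u' x - a x)) \<le> norm (c * (u' x - a x))"
      using c by eventually_elim (auto simp: abs_mult intro!: mult_right_mono)
  qed measurable
  have "rel_entropy \<Omega> a u - rel_entropy \<Omega> a u' - rel_entropy \<Omega> u' u
      = (\<integral>x. (a x - u' x) * (ln (u' x) - ln (u x)) \<partial>?M)"
    using lns u'_ln
    by (simp add: rel_entropy_eq[OF a u] rel_entropy_eq[OF a interior] rel_entropy_eq[OF u'_fin u]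
        entropy_integral_def algebra_simps)
  also have "\<dots> = (\<integral>x. \<tau> * (g x * (u' x - a x)) + ln Z * (u' x - a x) \<partial>?M)"
  proof (rule integral_cong_AE)
    show "AE x in ?M. (a x - u' x) * (ln (u' x) - ln (u x))
        = \<tau> * (g x * (u' x - a x)) + ln Z * (u' x - a x)"
      using ln_u'
    proof eventually_elim
      case (elim x)
      show ?case
        unfolding elim by (simp add: algebra_simps)
    qed
  qed measurable
  also have "\<dots> = \<tau> * pairing \<Omega> g (u' - a)"
    using g_int u'_int a_int u'_one by (simp add: pairing_def)
  also have "pairing \<Omega> g (u' - a) = pairing \<Gamma> v (K (u' - a))"
    unfolding g_def by (rule adjoint_op(2)[OF v diff_L1])
  finally show "rel_entropy \<Omega> a u - rel_entropy \<Omega> a u' - rel_entropy \<Omega> u' u = \<tau> * pairing \<Gamma> v (K (u' - a))" .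
qed

end

section \<open>The error estimate\<close>

text \<open>In the application \<open>A\<close> is \<open>C * \<delta>\<close>, \<open>e\<close> is
  D_B to the solution and \<open>d\<close> the dual error. Summation up to \<open>m\<close> keeps
  \<open>e m\<close> on the left; at the index of the largest \<open>d\<close> this term controls
  the square of that \<open>d\<close>, which closes the estimate.\<close>

lemma perturbed_telescoping_bound:
  fixes gap d e :: "nat \<Rightarrow> real"
  assumes \<nu>: "0 < \<nu>" and A: "0 \<le> A"
    and gap: "\<And>k. 0 \<le> gap (Suc k)" and d: "\<And>k. 0 \<le> d k"
    and e: "\<And>k. \<nu> / 2 * (d k)\<^sup>2 \<le> e k"
    and step: "\<And>k. gap (Suc k) \<le> e k - e (Suc k) + A * d (Suc k)"
    and n: "1 \<le> n"
  shows "(\<Sum>k = 1..n. gap k) \<le> e 0 + 2 * A\<^sup>2 / \<nu> * (real n)\<^sup>2 + 2 * A * real n * sqrt (e 0 / \<nu>)"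
proof -
  have e_nn: "0 \<le> e k" for k
    by (rule order_trans[OF _ e]) (use \<nu> in simp)
  have sum: "(\<Sum>k = 1..m. gap k) + e m \<le> e 0 + A * (\<Sum>k = 1..m. d k)" for m
  proof (induction m)
    case (Suc m)
    then show ?case
      using step[of m] by (simp add: algebra_simps)
  qed simp
  have gap_sum: "0 \<le> (\<Sum>k = 1..m. gap k)" for m
  proof (rule sum_nonneg)
    show "0 \<le> gap k" if "k \<in> {1..m}" for k
      using gap[of "k - 1"] that by simp
  qed
  define D where "D = Max (d ` {1..n})"
  have d_le: "d k \<le> D" if "k \<in> {1..n}" for k
    unfolding D_def using that by (intro Max_ge) auto
  have "D \<in> d ` {1..n}"
    unfolding D_def using n by (intro Max_in) auto
  then obtain m where m: "m \<in> {1..n}" "D = d m"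
    by auto
  have D_nn: "0 \<le> D"
    using m d by simp
  have d_sum: "(\<Sum>k = 1..j. d k) \<le> real n * D" if "j \<le> n" for j
  proof -
    have "(\<Sum>k = 1..j. d k) \<le> of_nat (card {1..j}) * D"
      using that d_le by (intro sum_bounded_above) auto
    also have "\<dots> \<le> real n * D"
      using that D_nn by (intro mult_right_mono) auto
    finally show ?thesis .
  qed
  \<comment> \<open>Chosen so that the inequality at the maximising index reads
    \<open>D * D \<le> s\<^sup>2 + P * D\<close>.\<close>
  define P s where "P = 2 * A * real n / \<nu>" and "s = sqrt (2 * (e 0 / \<nu>))"
  have Ps: "0 \<le> P" "0 \<le> s"
    using A \<nu> e_nn[of 0] by (simp_all add: P_def s_def)
  have "\<nu> / 2 * D\<^sup>2 \<le> e 0 + A * (real n * D)"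
    using e[of m] sum[of m] gap_sum[of m] mult_left_mono[OF d_sum A, of m] m by simp
  then have quad: "D * D \<le> s\<^sup>2 + P * D"
    using \<nu> e_nn[of 0] by (simp add: P_def s_def field_simps power2_eq_square)
  have "D \<le> P + s"
  proof (rule ccontr)
    assume "\<not> D \<le> P + s"
    then have "(P + s) * D < D * D" "s * s \<le> s * D"
      using Ps by (auto intro!: mult_strict_right_mono mult_left_mono)
    then show False
      using quad by (simp add: power2_eq_square algebra_simps)
  qed
  \<comment> \<open>The factor \<open>sqrt 2\<close> in \<open>s\<close> is relaxed to 2, the factor
    in the stated bound.\<close>
  have "s \<le> sqrt 4 * sqrt (e 0 / \<nu>)"
    unfolding s_def real_sqrt_mult[symmetric] using e_nn[of 0] \<nu> by (intro real_sqrt_le_mono mult_right_mono) auto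
  then have D: "D \<le> P + 2 * sqrt (e 0 / \<nu>)"
    using \<open>D \<le> P + s\<close> by simp
  have "(\<Sum>k = 1..n. gap k) \<le> e 0 + A * (real n * D)"
    using sum[of n] e_nn[of n] mult_left_mono[OF d_sum A, of n] by simp
  also have "\<dots> \<le> e 0 + A * (real n * (P + 2 * sqrt (e 0 / \<nu>)))"
    using A D by (intro add_left_mono mult_left_mono) auto
  also have "\<dots> = e 0 + 2 * A\<^sup>2 / \<nu> * (real n)\<^sup>2 + 2 * A * real n * sqrt (e 0 / \<nu>)"
    by (simp add: P_def algebra_simps power2_eq_square)
  finally show ?thesis .
qed

section \<open>Descent of D_B along the iteration and passage to ergodic means\<close>

context entropic_pdhg_setting
begin

context
  fixes f u' v' C f\<delta> \<delta> H\<delta> u v \<zeta>\<delta> \<zeta>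
  assumes f: "f \<in> L2 \<Gamma>" and u': "u' \<in> prob_simplex \<Omega>" and Ku': "AE x in lebesgue_on \<Gamma>. K u' x = f x"
    and v': "v' \<in> L2 \<Gamma>"
    and source: "- adjoint_op \<Omega> \<Gamma> K v' \<in> subdiff_L1 \<Omega> (indicator_functional (prob_simplex \<Omega>)) u'"
    and C: "0 < C" and \<delta>: "norm2 \<Gamma> (f - f\<delta>) \<le> \<delta>"
    and H: "proper_on (L2 \<Gamma>) H\<delta>"
    and alg: "entropic_pdhg \<Omega> \<Gamma> K \<tau> \<sigma> H\<delta> u v"
    and pert: "perturbation_condition \<Gamma> f H\<delta> \<delta> C v' v \<zeta>\<delta> \<zeta>"
begin

abbreviation F where
  "F \<equiv> conjugate_L2 \<Gamma> H\<delta>"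

lemma iterates_L2: "v k \<in> L2 \<Gamma>"
  using alg by (simp add: entropic_pdhg_def)

lemma iterates_interior: "u k \<in> interior_simplex \<Omega>"
proof (induction k)
  case 0
  show ?case
    using alg by (intro dom_subdifferential_entropy[OF \<Omega>]) (simp_all add: entropic_pdhg_def)
next
  case (Suc k)
  show ?case
    by (rule entropic_step(1)[OF Suc iterates_L2]) (use alg in \<open>auto simp: entropic_pdhg_def\<close>)
qed

lemma iterates_simplex: "u k \<in> prob_simplex \<Omega>"
  and iterates_L1: "u k \<in> L1 \<Omega>"
  using interior_simplexD[OF iterates_interior] by simp_all

lemma u'_L1: "u' \<in> L1 \<Omega>"
  using u' by (rule prob_simplex_L1)

lemma subgradient_\<zeta>\<delta>:
  shows "\<zeta>\<delta> \<in> L2 \<Gamma>" "\<bar>F v'\<bar> \<noteq> \<infinity>"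
    "x \<in> L2 \<Gamma> \<Longrightarrow> F v' + ereal (pairing \<Gamma> \<zeta>\<delta> (x - v')) \<le> F x"
  using pert by (simp_all add: perturbation_condition_def subdifferential_def)

lemma \<zeta>_L2: "\<zeta> \<in> L2 \<Gamma>"
  using pert by (simp add: perturbation_condition_def subdifferential_def)

text \<open>The exact-data subgradient acts as \<open>f\<close>, which is \<open>K u'\<close> almost
  everywhere. This brings the primal solution into the perturbation condition.\<close>

lemma pairing_\<zeta>:
  assumes q: "q \<in> L2 \<Gamma>"
  shows "pairing \<Gamma> \<zeta> q = pairing \<Gamma> q (K u')"
proof -
  have "pairing \<Gamma> \<zeta> q = pairing \<Gamma> f q"
    using pert by (intro subgradient_conjugate_indicator[OF f q]) (auto simp: perturbation_condition_def)
  also have "\<dots> = pairing \<Gamma> q (K u')"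
    using pairing_cong_AE_L2[OF q K_L2[OF u'_L1] f Ku'] by (simp add: pairing_commute[of \<Gamma> f q])
  finally show ?thesis .
qed

lemma prox_step: "v (Suc k) \<in> prox \<Gamma> \<sigma> F (v k + \<sigma> *\<^sub>R K (2 *\<^sub>R u (Suc k) - u k))"
  using alg by (simp add: entropic_pdhg_def)

text \<open>The subgradient at \<open>v'\<close> excludes \<open>-\<infinity>\<close>. The value
  \<open>\<infinity>\<close> is excluded because \<open>v'\<close>, where \<open>F\<close> is
  finite, competes with \<open>v (Suc k)\<close> in the proximal problem.\<close>

lemma F_finite: "\<bar>F (v (Suc k))\<bar> \<noteq> \<infinity>"
proof -
  have "F (v (Suc k)) \<noteq> - \<infinity>"
    using subgradient_\<zeta>\<delta>(2) subgradient_\<zeta>\<delta>(3)[OF iterates_L2[of "Suc k"]] by auto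
  moreover have "F (v (Suc k)) \<noteq> \<infinity>"
    using prox_step[of k] v' subgradient_\<zeta>\<delta>(2) by (fastforce simp: prox_def)
  ultimately show ?thesis
    by auto
qed

text \<open>The sum of the two Bregman distances at the \<open>k\<close>-th iterate as a real
  number. The indicator vanishes on the simplex, so its distance is the linear term alone, carried
  over to \<open>\<Gamma>\<close> by the adjoint.\<close>

definition gap where
  "gap k = pairing \<Gamma> v' (K (u k - u')) + (real_of_ereal (F (v k)) - real_of_ereal (F v'))
    - pairing \<Gamma> \<zeta>\<delta> (v k - v')"

lemma source_nonneg:
  assumes x: "x \<in> prob_simplex \<Omega>"
  shows "0 \<le> pairing \<Gamma> v' (K (x - u'))"
proof -
  have "pairing \<Omega> (- adjoint_op \<Omega> \<Gamma> K v') (x - u') \<le> 0"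
    using source x u' prob_simplex_L1[OF x]
    by (auto simp: subdifferential_def indicator_functional_def dest!: bspec[of _ _ x])
  moreover have "pairing \<Omega> (- adjoint_op \<Omega> \<Gamma> K v') (x - u') = - pairing \<Omega> (adjoint_op \<Omega> \<Gamma> K v') (x - u')"
    by (simp add: pairing_def)
  ultimately show ?thesis
    using adjoint_op(2)[OF v' L1_diff[OF prob_simplex_L1[OF x] u'_L1]] by simp
qed

lemma gap_nonneg: "0 \<le> gap (Suc k)"
proof -
  obtain a b where ab: "F (v (Suc k)) = ereal a" "F v' = ereal b"
    using F_finite[of k] subgradient_\<zeta>\<delta>(2) by auto
  then have "b + pairing \<Gamma> \<zeta>\<delta> (v (Suc k) - v') \<le> a"
    using subgradient_\<zeta>\<delta>(3)[OF iterates_L2[of "Suc k"]] by simp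
  then show ?thesis
    using source_nonneg[OF iterates_simplex[of "Suc k"]] by (simp add: gap_def ab)
qed

text \<open>Four relations are added: the three-point identity for the relative entropy, the
  variational inequality of the proximal step, the expansion of the dual norms, and the perturbation
  condition. The bilinear terms left over are exactly those of the three distances D_B.\<close>

lemma gap_step:
  assumes fin: "u' \<in> finite_entropy_simplex \<Omega>"
  shows "gap (Suc k) \<le> B_distance u' v' (u k) (v k) - B_distance u' v' (u (Suc k)) (v (Suc k))
    + C * \<delta> * norm2 \<Gamma> (v' - v (Suc k))"
proof -
  define x y p q where "x = u k" and "y = u (Suc k)" and "p = v k" and "q = v (Suc k)"
  have L1: "x \<in> L1 \<Omega>" "y \<in> L1 \<Omega>" "u' \<in> L1 \<Omega>" and L2: "p \<in> L2 \<Gamma>" "q \<in> L2 \<Gamma>" "v' \<in> L2 \<Gamma>"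
    using iterates_L1 iterates_L2 v' u'_L1 by (simp_all add: x_def y_def p_def q_def)
  have interior: "x \<in> interior_simplex \<Omega>" "y \<in> interior_simplex \<Omega>"
    using iterates_interior by (simp_all add: x_def y_def)
  obtain a b where ab: "F q = ereal a" "F v' = ereal b"
    using F_finite[of k] subgradient_\<zeta>\<delta>(2) by (auto simp: q_def)
  \<comment> \<open>D_B of the new iterate to the old one appears with a minus sign and is
    dropped.\<close>
  have dist_yx: "0 \<le> B_distance y q x p"
    using interior_simplexD(1) interior L2 by (intro B_distance_nonneg)
  have "rel_entropy \<Omega> u' x - rel_entropy \<Omega> u' y - rel_entropy \<Omega> y x = \<tau> * pairing \<Gamma> p (K (y - u'))"
    unfolding x_def y_def p_def
    by (rule entropic_step(2)[OF iterates_interior iterates_L2 iterates_L1 _ fin])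
      (use alg in \<open>simp add: entropic_pdhg_def\<close>)
  then have u_step: "rel_entropy \<Omega> u' x / \<tau> = rel_entropy \<Omega> u' y / \<tau> + rel_entropy \<Omega> y x / \<tau>
      + pairing \<Gamma> p (K (y - u'))"
    using \<tau> by (simp add: field_simps)
  have K2: "2 *\<^sub>R y - x \<in> L1 \<Omega>"
    using L1 by (simp add: L1_diff L1_scaleR)
  have "a - b \<le> pairing \<Gamma> (p + \<sigma> *\<^sub>R K (2 *\<^sub>R y - x) - q) (q - v') / \<sigma>"
    using prox_step[of k] L2 K2 unfolding x_def[symmetric] y_def[symmetric] p_def[symmetric] q_def[symmetric]
    by (intro prox_variational_ineq[OF H \<sigma> _ _ _ ab] L2_add L2_scaleR K_L2)
  also have "pairing \<Gamma> (p + \<sigma> *\<^sub>R K (2 *\<^sub>R y - x) - q) (q - v')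
      = pairing \<Gamma> (p - q) (q - v') + \<sigma> * pairing \<Gamma> (q - v') (K (2 *\<^sub>R y - x))"
    using L2 K2 K_L2[OF K2]
    by (simp add: pairing_add_left pairing_diff_left pairing_scaleR_left L2_diff L2_add L2_scaleR
        pairing_commute[of \<Gamma> "K (2 *\<^sub>R y - x)"])
  finally have v_step: "a - b \<le> pairing \<Gamma> (p - q) (q - v') / \<sigma> + pairing \<Gamma> (q - v') (K (2 *\<^sub>R y - x))"
    using \<sigma> by (simp add: add_divide_distrib)
  have "(norm2 \<Gamma> (v' - p))\<^sup>2 = (norm2 \<Gamma> (v' - q))\<^sup>2 + (norm2 \<Gamma> (q - p))\<^sup>2 + 2 * pairing \<Gamma> (p - q) (q - v')"
  proof -
    have "pairing \<Gamma> (v' - q) (q - p) = pairing \<Gamma> (p - q) (q - v')"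
      unfolding pairing_def by (intro Bochner_Integration.integral_cong) (simp_all add: algebra_simps)
    then show ?thesis
      using power2_norm2_add_scaleR[of "v' - q" \<Gamma> "q - p" 1] L2 by (simp add: L2_diff)
  qed
  then have norms: "(norm2 \<Gamma> (v' - p))\<^sup>2 / (2 * \<sigma>) = (norm2 \<Gamma> (v' - q))\<^sup>2 / (2 * \<sigma>)
      + (norm2 \<Gamma> (q - p))\<^sup>2 / (2 * \<sigma>) + pairing \<Gamma> (p - q) (q - v') / \<sigma>"
    by (simp add: add_divide_distrib)
  have "pairing \<Gamma> (\<zeta>\<delta> - \<zeta>) (v' - q) \<le> C * \<delta> * norm2 \<Gamma> (v' - q)"
    using pert by (simp add: perturbation_condition_def q_def)
  moreover have "pairing \<Gamma> (\<zeta>\<delta> - \<zeta>) (v' - q) = pairing \<Gamma> (q - v') (K u') - pairing \<Gamma> \<zeta>\<delta> (q - v')"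
    using L2 subgradient_\<zeta>\<delta>(1) \<zeta>_L2 pairing_\<zeta>[of "q - v'"]
    by (simp add: pairing_linear L2_diff)
  ultimately have noise: "- pairing \<Gamma> \<zeta>\<delta> (q - v') \<le> C * \<delta> * norm2 \<Gamma> (v' - q) - pairing \<Gamma> (q - v') (K u')"
    by simp
  \<comment> \<open>Here the extrapolation \<open>2 *\<^sub>R y - x\<close> pays off: it supplies
    the cross terms with the old iterate that the distances contain.\<close>
  have bilinear: "pairing \<Gamma> v' (K (y - u')) + pairing \<Gamma> (q - v') (K (2 *\<^sub>R y - x)) - pairing \<Gamma> (q - v') (K u')
      = pairing \<Gamma> p (K (y - u')) - pairing \<Gamma> (v' - p) (K (u' - x))
        + pairing \<Gamma> (v' - q) (K (u' - y)) + pairing \<Gamma> (q - p) (K (y - x))"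
  proof -
    have K_diff: "pairing \<Gamma> r (K (y - u')) = pairing \<Gamma> r (K y) - pairing \<Gamma> r (K u')"
      "pairing \<Gamma> r (K (u' - y)) = pairing \<Gamma> r (K u') - pairing \<Gamma> r (K y)"
      "pairing \<Gamma> r (K (u' - x)) = pairing \<Gamma> r (K u') - pairing \<Gamma> r (K x)"
      "pairing \<Gamma> r (K (y - x)) = pairing \<Gamma> r (K y) - pairing \<Gamma> r (K x)"
      "pairing \<Gamma> r (K (2 *\<^sub>R y - x)) = 2 * pairing \<Gamma> r (K y) - pairing \<Gamma> r (K x)"
      if "r \<in> L2 \<Gamma>" for r
      using that L1 by (simp_all add: pairing_K_diff pairing_K_scaleR L1_scaleR)
    have diff_K: "pairing \<Gamma> (r - s) (K w) = pairing \<Gamma> r (K w) - pairing \<Gamma> s (K w)"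
      if "r \<in> L2 \<Gamma>" "s \<in> L2 \<Gamma>" "w \<in> L1 \<Omega>" for r s w
      using that by (simp add: pairing_diff_left K_L2)
    show ?thesis
      using L1 L2 by (simp add: K_diff diff_K L2_diff)
  qed
  have "gap (Suc k) = pairing \<Gamma> v' (K (y - u')) + (a - b) - pairing \<Gamma> \<zeta>\<delta> (q - v')"
    using ab by (simp add: gap_def y_def q_def)
  then show ?thesis
    using v_step u_step norms noise bilinear dist_yx
    unfolding B_distance_def x_def[symmetric] y_def[symmetric] p_def[symmetric] q_def[symmetric]
    by linarith
qed

text \<open>On the simplex the primal distance is affine in its first argument, so averaging is
  exact there; for the conjugate Jensen's inequality is used, and its subgradient term is again
  affine.\<close>

lemma ergodic_gap:
  assumes n: "1 \<le> n"
  shows "bregman \<Omega> (indicator_functional (prob_simplex \<Omega>)) (- adjoint_op \<Omega> \<Gamma> K v') (ergodic_mean u n) u'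
      + bregman \<Gamma> F \<zeta>\<delta> (ergodic_mean v n) v' \<le> ereal ((\<Sum>k = 1..n. gap k) / real n)"
proof -
  define U V where "U = ergodic_mean u n" and "V = ergodic_mean v n"
  have U: "U \<in> prob_simplex \<Omega>"
    unfolding U_def using n iterates_simplex by (intro ergodic_mean_in_convex convex_prob_simplex)
  have VL2: "V \<in> L2 \<Gamma>"
    unfolding V_def by (intro ergodic_mean_L2 iterates_L2)
  define a where "a k = real_of_ereal (F (v k))" for k
  have a: "F (v k) = ereal (a k)" if "1 \<le> k" for k
    using F_finite[of "k - 1"] that by (simp add: a_def ereal_real)
  obtain b where b: "F v' = ereal b"
    using subgradient_\<zeta>\<delta>(2) by auto
  have FV: "F V \<le> ereal ((\<Sum>k = 1..n. a k) / real n)"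
    unfolding V_def by (rule conjugate_L2_ergodic_mean[OF H n iterates_L2 a])
  have "bregman \<Gamma> F \<zeta>\<delta> V v' = F V - ereal (b + pairing \<Gamma> \<zeta>\<delta> (V - v'))"
    by (cases "F V") (simp_all add: bregman_def b)
  also have "\<dots> \<le> ereal ((\<Sum>k = 1..n. a k) / real n) - ereal (b + pairing \<Gamma> \<zeta>\<delta> (V - v'))"
    using FV by (rule ereal_minus_mono) simp
  finally have D_F: "bregman \<Gamma> F \<zeta>\<delta> V v' \<le> ereal ((\<Sum>k = 1..n. a k) / real n - b - pairing \<Gamma> \<zeta>\<delta> (V - v'))"
    by (simp add: algebra_simps)
  have "bregman \<Omega> (indicator_functional (prob_simplex \<Omega>)) (- adjoint_op \<Omega> \<Gamma> K v') U u'
      = ereal (pairing \<Omega> (adjoint_op \<Omega> \<Gamma> K v') (U - u'))"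
    using U u' by (simp add: bregman_def indicator_functional_def pairing_def)
  also have "\<dots> = ereal (pairing \<Gamma> v' (K U) - pairing \<Gamma> v' (K u'))"
    using prob_simplex_L1[OF U] u'_L1 by (simp add: adjoint_op(2)[OF v'] pairing_K_diff[OF v'] L1_diff)
  finally have D_R: "bregman \<Omega> (indicator_functional (prob_simplex \<Omega>)) (- adjoint_op \<Omega> \<Gamma> K v') U u'
      = ereal (pairing \<Gamma> v' (K U) - pairing \<Gamma> v' (K u'))" .
  have KU: "pairing \<Gamma> v' (K U) = (\<Sum>k = 1..n. pairing \<Gamma> v' (K (u k))) / real n"
  proof -
    have "pairing \<Gamma> v' (K (\<Sum>k = 1..m. u k)) = (\<Sum>k = 1..m. pairing \<Gamma> v' (K (u k)))" for m
    proof (induction m)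
      case 0
      \<comment> \<open>\<open>K 0\<close> vanishes only almost everywhere; its pairing is zero by
        homogeneity with factor 0.\<close>
      show ?case
        using pairing_K_scaleR[OF v', of 0 0] by (simp add: L1_iff zero_fun_def)
    next
      case (Suc m)
      then show ?case
        using pairing_K_add[OF v' L1_sum iterates_L1, of "{1..m}" u "Suc m"] iterates_L1
        by (simp add: plus_fun_def)
    qed
    then show ?thesis
      unfolding U_def ergodic_mean_def
      using pairing_K_scaleR[OF v' L1_sum, of "{1..n}" u] iterates_L1 by simp
  qed
  have "pairing \<Gamma> V \<zeta>\<delta> = (\<Sum>k = 1..n. pairing \<Gamma> (v k) \<zeta>\<delta>) / real n"
    unfolding V_def by (rule pairing_ergodic_mean_left[OF subgradient_\<zeta>\<delta>(1) iterates_L2])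
  then have \<zeta>V: "pairing \<Gamma> \<zeta>\<delta> (V - v') = (\<Sum>k = 1..n. pairing \<Gamma> \<zeta>\<delta> (v k)) / real n - pairing \<Gamma> \<zeta>\<delta> v'"
    using VL2 v' subgradient_\<zeta>\<delta>(1) by (simp add: pairing_diff_left pairing_commute[of \<Gamma> \<zeta>\<delta>])
  have "gap k = pairing \<Gamma> v' (K (u k)) + a k - pairing \<Gamma> \<zeta>\<delta> (v k)
      + (pairing \<Gamma> \<zeta>\<delta> v' - pairing \<Gamma> v' (K u') - b)" for k
    using v' subgradient_\<zeta>\<delta>(1) iterates_L1 iterates_L2 u'_L1
    by (simp add: gap_def a_def b pairing_K_diff pairing_diff_right)
  then have "(\<Sum>k = 1..n. gap k) / real n = pairing \<Gamma> v' (K U) - pairing \<Gamma> v' (K u')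
      + ((\<Sum>k = 1..n. a k) / real n - b - pairing \<Gamma> \<zeta>\<delta> (V - v'))"
    using n by (simp add: sum.distrib sum_subtractf KU \<zeta>V add_divide_distrib diff_divide_distrib)
  then have "ereal ((\<Sum>k = 1..n. gap k) / real n) = ereal (pairing \<Gamma> v' (K U) - pairing \<Gamma> v' (K u'))
      + ereal ((\<Sum>k = 1..n. a k) / real n - b - pairing \<Gamma> \<zeta>\<delta> (V - v'))"
    by simp
  then show ?thesis
    unfolding U_def[symmetric] V_def[symmetric] D_R using D_F by (simp only: add_left_mono)
qed

lemma error_estimate:
  assumes n: "1 \<le> n"
  shows "bregman \<Omega> (indicator_functional (prob_simplex \<Omega>)) (- adjoint_op \<Omega> \<Gamma> K v') (ergodic_mean u n) u'
      + bregman \<Gamma> F \<zeta>\<delta> (ergodic_mean v n) v'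
    \<le> ereal (1 / real n) * bregman_dd B (u', v') (u 0, v 0) + ereal (2 * C\<^sup>2 / \<nu> * \<delta>\<^sup>2 * real n)
      + ereal (2 * C * \<delta>) * ereal_sqrt (bregman_dd B (u', v') (u 0, v 0) / ereal \<nu>)"
proof -
  have \<delta>_nn: "0 \<le> \<delta>"
    using norm2_nonneg \<delta> by (rule order_trans)
  show ?thesis
  proof (cases "u' \<in> finite_entropy_simplex \<Omega>")
    case True
    define e d where "e k = B_distance u' v' (u k) (v k)" and "d k = norm2 \<Gamma> (v' - v k)" for k
    have dd: "bregman_dd B (u', v') (u 0, v 0) = ereal (e 0)"
      unfolding e_def by (rule bregman_dd_B_eq[OF True iterates_interior v' iterates_L2])
    have "(\<Sum>k = 1..n. gap k) \<le> e 0 + 2 * (C * \<delta>)\<^sup>2 / \<nu> * (real n)\<^sup>2 + 2 * (C * \<delta>) * real n * sqrt (e 0 / \<nu>)"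
    proof (rule perturbed_telescoping_bound[OF \<nu>_pos, where d = d])
      show "0 \<le> C * \<delta>"
        using C \<delta>_nn by simp
      show "0 \<le> d k" for k
        by (simp add: d_def norm2_nonneg)
      show "\<nu> / 2 * (d k)\<^sup>2 \<le> e k" for k
        unfolding d_def e_def by (rule B_distance_ge[OF True iterates_interior v' iterates_L2])
      show "0 \<le> gap (Suc k)" for k
        by (rule gap_nonneg)
      show "gap (Suc k) \<le> e k - e (Suc k) + C * \<delta> * d (Suc k)" for k
        unfolding d_def e_def by (rule gap_step[OF True])
    qed (rule n)
    then have "(\<Sum>k = 1..n. gap k) / real n
        \<le> (e 0 + 2 * (C * \<delta>)\<^sup>2 / \<nu> * (real n)\<^sup>2 + 2 * (C * \<delta>) * real n * sqrt (e 0 / \<nu>)) / real n"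
      by (rule divide_right_mono) simp
    also have "\<dots> = 1 / real n * e 0 + 2 * C\<^sup>2 / \<nu> * \<delta>\<^sup>2 * real n + 2 * C * \<delta> * sqrt (e 0 / \<nu>)"
      using n by (simp add: add_divide_distrib power2_eq_square)
    finally have "ereal ((\<Sum>k = 1..n. gap k) / real n)
        \<le> ereal (1 / real n * e 0 + 2 * C\<^sup>2 / \<nu> * \<delta>\<^sup>2 * real n + 2 * C * \<delta> * sqrt (e 0 / \<nu>))"
      by simp
    also have "\<dots> = ereal (1 / real n) * bregman_dd B (u', v') (u 0, v 0) + ereal (2 * C\<^sup>2 / \<nu> * \<delta>\<^sup>2 * real n)
        + ereal (2 * C * \<delta>) * ereal_sqrt (bregman_dd B (u', v') (u 0, v 0) / ereal \<nu>)"
      using \<nu>_pos by (simp add: dd ereal_sqrt_def)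
    finally show ?thesis
      by (rule order_trans[OF ergodic_gap[OF n]])
  next
    case False
    have dd: "bregman_dd B (u', v') (u 0, v 0) = \<infinity>"
      using False u' interior_simplexD(1)[OF iterates_interior] by (rule bregman_dd_B_eq_infinity)
    \<comment> \<open>The first summand is infinite. \<open>\<delta> = 0\<close> is split off
      because \<open>0 * \<infinity> = 0\<close> then removes the last summand, which is infinite
      otherwise.\<close>
    show ?thesis
      using n \<nu>_pos C \<delta>_nn by (cases "\<delta> = 0") (simp_all add: dd ereal_sqrt_def)
  qed
qed

end

end

theorem proposition6p4:
  fixes \<Omega> \<Gamma> :: "point set" and K :: "fn \<Rightarrow> fn" and \<tau> \<sigma> :: real
  assumes "\<Omega> \<in> sets lebesgue" and "\<Gamma> \<in> sets lebesgue"
    and "bounded_linear_L1_L2 \<Omega> \<Gamma> K"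
    and "0 < \<tau>" and "0 < \<sigma>" and "\<tau> * \<sigma> * (op_norm \<Omega> \<Gamma> K)\<^sup>2 < 1"
  defines "R \<equiv> indicator_functional (prob_simplex \<Omega>)"
    and "B \<equiv> B_functional \<Omega> \<Gamma> K \<tau> \<sigma>"
  shows "convex_functional_on (prob_simplex \<Omega> \<times> L2 \<Gamma>) B \<and>
    (\<forall>f u' v' C.
       f \<in> L2 \<Gamma> \<and> u' \<in> prob_simplex \<Omega> \<and> (AE x in lebesgue_on \<Gamma>. K u' x = f x) \<and>
       v' \<in> L2 \<Gamma> \<and> - adjoint_op \<Omega> \<Gamma> K v' \<in> subdiff_L1 \<Omega> R u' \<and> 0 < C \<longrightarrow>
       (\<exists>\<nu>>0. \<exists>C'>0. \<forall>f\<delta> \<delta> H\<delta> u v \<zeta>\<delta> \<zeta>.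
          f\<delta> \<in> L2 \<Gamma> \<and> norm2 \<Gamma> (f - f\<delta>) \<le> \<delta> \<and>
          proper_on (L2 \<Gamma>) H\<delta> \<and> convex_functional_on (L2 \<Gamma>) H\<delta> \<and> lsc_L2 \<Gamma> H\<delta> \<and>
          entropic_pdhg \<Omega> \<Gamma> K \<tau> \<sigma> H\<delta> u v \<and>
          perturbation_condition \<Gamma> f H\<delta> \<delta> C v' v \<zeta>\<delta> \<zeta> \<longrightarrow>
          (\<forall>n\<ge>1.
             bregman \<Omega> R (- adjoint_op \<Omega> \<Gamma> K v') (ergodic_mean u n) u' +
             bregman \<Gamma> (conjugate_L2 \<Gamma> H\<delta>) \<zeta>\<delta> (ergodic_mean v n) v'
             \<le> ereal (1 / real n) * bregman_dd B (u', v') (u 0, v 0) +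
               ereal (2 * C'\<^sup>2 / \<nu> * \<delta>\<^sup>2 * real n) +
               ereal (2 * C * \<delta>) * ereal_sqrt (bregman_dd B (u', v') (u 0, v 0) / ereal \<nu>))))"
proof -
  interpret entropic_pdhg_setting \<Omega> \<Gamma> K \<tau> \<sigma>
    by unfold_locales (fact assms(1) assms(3-6))+
  show ?thesis
    unfolding R_def B_def
  proof (intro conjI allI impI, goal_cases)
    case 1
    show ?case
      by (rule convex_B)
  next
    case (2 f u' v' C)
    then have *: "f \<in> L2 \<Gamma>" "u' \<in> prob_simplex \<Omega>" "AE x in lebesgue_on \<Gamma>. K u' x = f x" "v' \<in> L2 \<Gamma>"
      "- adjoint_op \<Omega> \<Gamma> K v' \<in> subdiff_L1 \<Omega> (indicator_functional (prob_simplex \<Omega>)) u'" "0 < C"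
      by simp_all
    \<comment> \<open>\<open>\<nu>\<close> involves only \<open>\<tau>\<close>,
      \<open>\<sigma>\<close> and the operator norm, so it can be fixed before the noisy data and
      the iterates are given.\<close>
    show ?case
    proof (rule exI[of _ \<nu>], rule conjI[OF \<nu>_pos], rule exI[of _ C], rule conjI[OF *(6)],
        intro allI impI, elim conjE, goal_cases)
      case 1
      show ?case
        by (rule error_estimate[OF * 1(3,4,7,8,1)])
    qed
  qed
qed

end
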